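(* Let $f:\mathbb{R}\times\mathbb{R}^m\to\mathbb{R}$ be convex with at most quadratic growth and let $g:\mathbb{R}^n\to\mathbb{R}$ be convex and Lipschitz continuous. Suppose that the control set $\mathbb{A}$ is convex and that the map $(A,y)\mapsto f(g(X^A_T),y)$ on $\mathcal{A}\times\mathbb{R}^m$ is jointly convex, almost surely. Then the function $V:\mathbb{R}^m\to\mathbb{R}$ defined by $V(y):=\inf_{A\in\mathcal{A}}\mathbb{E}[f(g(X^A_T),y)]$ is convex.
   Context: Setting. Fix $T>0$. $(\Omega,\mathcal{F},\mathbb{P})$ is a probability space supporting a standard $d$-dimensional Brownian motion $W$ with filtration $\{\mathcal{F}_t\}_{0\le t\le T}$ satisfying the usual conditions. $\mathbb{A}$ is a compact subset of a finite-dimensional Euclidean space; $\mathcal{A}$ is the set of all $\mathcal{F}_t$-progressively measurable processes valued in $\mathbb{A}$ almost surely. The functions $\mu:\mathbb{R}^n\times\mathbb{A}\to\mathbb{R}^n$ and $\sigma:\mathbb{R}^n\times\mathbb{A}\to\mathbb{R}^{n\times d}$ are continuous and for some $K>0$ satisfy $\|\mu(x,a)-\mu(x',a)\|+\|\sigma(x,a)-\sigma(x',a)\|\le K\|x-x'\|$ and $\|\mu(x,a)\|+\|\sigma(x,a)\|\le K(1+\|x\|+\|a\|)$ for all $x,x'\in\mathbb{R}^n$, $a\in\mathbb{A}$. For $A\in\mathcal{A}$, $X^A$ is the unique strong solution of $dX^A_t=\mu(X^A_t,A_t)\,dt+\sigma(X^A_t,A_t)\,dW_t$, $X^A_0=\bm{x}_0$,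 with $\bm{x}_0\in\mathbb{R}^n$ fixed. Joint convexity, almost surely, means: for all $A,A'\in\mathcal{A}$, $y,y'\in\mathbb{R}^m$, $\theta\in[0,1]$, almost surely $f(g(X^{\theta A+(1-\theta)A'}_T),\theta y+(1-\theta)y')\le\theta f(g(X^A_T),y)+(1-\theta)f(g(X^{A'}_T),y')$. *)

theory Defs
  imports "HOL-Probability.Probability"
begin

section \<open>Filtrations, Brownian motion and progressive measurability on a finite horizon\<close>

definition usual_filtration :: "'w measure \<Rightarrow> real \<Rightarrow> (real \<Rightarrow> 'w measure) \<Rightarrow> bool" where
  "usual_filtration M T F \<longleftrightarrow>
     (\<forall>t\<in>{0..T}. subalgebra M (F t)) \<and>
     (\<forall>s\<in>{0..T}. \<forall>t\<in>{0..T}. s \<le> t \<longrightarrow> sets (F s) \<subseteq> sets (F t)) \<and>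
     (\<forall>t\<in>{0..<T}. sets (F t) = (\<Inter>s\<in>{t<..T}. sets (F s))) \<and>
     (\<forall>N\<in>null_sets M. \<forall>B\<subseteq>N. B \<in> sets (F 0))"

definition adapted ::
  "real \<Rightarrow> (real \<Rightarrow> 'w measure) \<Rightarrow> (real \<Rightarrow> 'w \<Rightarrow> 'b::topological_space) \<Rightarrow> bool" where
  "adapted T F Y \<longleftrightarrow> (\<forall>t\<in>{0..T}. Y t \<in> borel_measurable (F t))"

definition progressively_measurable ::
  "real \<Rightarrow> (real \<Rightarrow> 'w measure) \<Rightarrow> (real \<Rightarrow> 'w \<Rightarrow> 'b::topological_space) \<Rightarrow> bool" where
  "progressively_measurable T F Y \<longleftrightarrow>
     (\<forall>t\<in>{0..T}. (\<lambda>(s, \<omega>). Y s \<omega>) \<in>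
        borel_measurable (restrict_space borel {0..t} \<Otimes>\<^sub>M F t))"

definition continuous_paths ::
  "'w measure \<Rightarrow> real \<Rightarrow> (real \<Rightarrow> 'w \<Rightarrow> 'b::topological_space) \<Rightarrow> bool" where
  "continuous_paths M T Y \<longleftrightarrow> (AE \<omega> in M. continuous_on {0..T} (\<lambda>t. Y t \<omega>))"

definition brownian_motion ::
  "'w measure \<Rightarrow> real \<Rightarrow> (real \<Rightarrow> 'w measure) \<Rightarrow> (real \<Rightarrow> 'w \<Rightarrow> real ^ 'd) \<Rightarrow> bool" where
  "brownian_motion M T F W \<longleftrightarrow>
     adapted T F W \<and>
     (AE \<omega> in M. W 0 \<omega> = 0) \<and>
     continuous_paths M T W \<and>
     (\<forall>s t. 0 \<le> s \<and> s < t \<and> t \<le> T \<longrightarrow>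
        prob_space.indep_set M (sets (F s))
          {(\<lambda>\<omega>. W t \<omega> - W s \<omega>) -` B \<inter> space M | B. B \<in> sets borel} \<and>
        prob_space.indep_vars M (\<lambda>_. borel) (\<lambda>i \<omega>. (W t \<omega> - W s \<omega>) $ i) UNIV \<and>
        (\<forall>i. distributed M lborel (\<lambda>\<omega>. (W t \<omega> - W s \<omega>) $ i)
               (\<lambda>x. ennreal (normal_density 0 (sqrt (t - s)) x))))"

section \<open>The Ito integral\<close>

definition tendsto_in_probability ::
  "'w measure \<Rightarrow> (nat \<Rightarrow> 'w \<Rightarrow> 'b::{metric_space, second_countable_topology}) \<Rightarrow> ('w \<Rightarrow> 'b) \<Rightarrow> bool"
  where
  "tendsto_in_probability M Y Z \<longleftrightarrow>
     (\<forall>k. Y k \<in> borel_measurable M) \<and> Z \<in> borel_measurable M \<and>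
     (\<forall>\<epsilon>>0. (\<lambda>k. measure M {\<omega> \<in> space M. \<epsilon> < dist (Y k \<omega>) (Z \<omega>)}) \<longlonglongrightarrow> 0)"

text \<open>
  A simple integrand is given by its number \<open>p\<close> of steps, a deterministic partition
  \<open>0 = \<tau> 0 < \<dots> < \<tau> p = T\<close> and random matrices \<open>\<xi> i\<close>; it takes
  the value \<open>\<xi> i\<close> on the time interval from \<open>\<tau> i\<close> (excluded) to \<open>\<tau> (Suc i)\<close> (included).
\<close>

definition simple_integrand ::
  "'w measure \<Rightarrow> real \<Rightarrow> (real \<Rightarrow> 'w measure) \<Rightarrow> nat \<Rightarrow> (nat \<Rightarrow> real) \<Rightarrow>
   (nat \<Rightarrow> 'w \<Rightarrow> real ^ 'd ^ 'n) \<Rightarrow> bool" where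
  "simple_integrand M T F p \<tau> \<xi> \<longleftrightarrow>
     \<tau> 0 = 0 \<and> \<tau> p = T \<and> (\<forall>i<p. \<tau> i < \<tau> (Suc i)) \<and>
     (\<forall>i<p. \<xi> i \<in> borel_measurable (F (\<tau> i)) \<and> bounded (\<xi> i ` space M))"

definition simple_process ::
  "nat \<Rightarrow> (nat \<Rightarrow> real) \<Rightarrow> (nat \<Rightarrow> 'w \<Rightarrow> real ^ 'd ^ 'n) \<Rightarrow> real \<Rightarrow> 'w \<Rightarrow> real ^ 'd ^ 'n" where
  "simple_process p \<tau> \<xi> t \<omega> = (\<Sum>i<p. indicator {\<tau> i<..\<tau> (Suc i)} t *\<^sub>R \<xi> i \<omega>)"

definition simple_integral ::
  "(real \<Rightarrow> 'w \<Rightarrow> real ^ 'd) \<Rightarrow> nat \<Rightarrow> (nat \<Rightarrow> real) \<Rightarrow> (nat \<Rightarrow> 'w \<Rightarrow> real ^ 'd ^ 'n) \<Rightarrow>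
   real \<Rightarrow> 'w \<Rightarrow> real ^ 'n" where
  "simple_integral W p \<tau> \<xi> t \<omega> =
     (\<Sum>i<p. \<xi> i \<omega> *v (W (min t (\<tau> (Suc i))) \<omega> - W (min t (\<tau> i)) \<omega>))"

text \<open>
  \<open>is_ito_integral M T F W H I\<close>: the process \<open>I\<close> is a version of the stochastic integral of \<open>H\<close>
  against \<open>W\<close> from \<open>0\<close> to \<open>t\<close>, for \<open>t\<close> in \<open>{0..T}\<close>. Here \<open>H\<close> is only required to have almost
  surely square-integrable paths (no moment condition), and \<open>I\<close> is the limit in probability of
  the integrals of simple integrands that approximate \<open>H\<close> in \<open>L\<^sup>2([0,T])\<close>, in probability.
\<close>

definition is_ito_integral ::
  "'w measure \<Rightarrow> real \<Rightarrow> (real \<Rightarrow> 'w measure) \<Rightarrow> (real \<Rightarrow> 'w \<Rightarrow> real ^ 'd) \<Rightarrow>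
   (real \<Rightarrow> 'w \<Rightarrow> real ^ 'd ^ 'n) \<Rightarrow> (real \<Rightarrow> 'w \<Rightarrow> real ^ 'n) \<Rightarrow> bool" where
  "is_ito_integral M T F W H I \<longleftrightarrow>
     (AE \<omega> in M. set_borel_measurable lborel {0..T} (\<lambda>s. H s \<omega>) \<and>
                 set_integrable lborel {0..T} (\<lambda>s. (norm (H s \<omega>))\<^sup>2)) \<and>
     (\<exists>p \<tau> \<xi>.
        (\<forall>k. simple_integrand M T F (p k) (\<tau> k) (\<xi> k)) \<and>
        tendsto_in_probability M
          (\<lambda>k \<omega>. LINT s:{0..T}|lborel. (norm (simple_process (p k) (\<tau> k) (\<xi> k) s \<omega> - H s \<omega>))\<^sup>2)
          (\<lambda>_. 0) \<and>
        (\<forall>t\<in>{0..T}. tendsto_in_probability M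
          (\<lambda>k. simple_integral W (p k) (\<tau> k) (\<xi> k) t) (I t)))"

section \<open>Controls and controlled diffusions\<close>

definition admissible_controls ::
  "'w measure \<Rightarrow> real \<Rightarrow> (real \<Rightarrow> 'w measure) \<Rightarrow> 'c::euclidean_space set \<Rightarrow>
   (real \<Rightarrow> 'w \<Rightarrow> 'c) set" where
  "admissible_controls M T F \<AA> =
     {A. progressively_measurable T F A \<and> (AE \<omega> in M. \<forall>t\<in>{0..T}. A t \<omega> \<in> \<AA>)}"

text \<open>
  Strong solution, on the given probability space and with respect to the given \<open>F\<close> and \<open>W\<close>, of
  \<open>dX = \<mu>(X, A) dt + \<sigma>(X, A) dW\<close> with \<open>X 0 = x0\<close>.
\<close>

definition strong_solution ::
  "'w measure \<Rightarrow> real \<Rightarrow> (real \<Rightarrow> 'w measure) \<Rightarrow> (real \<Rightarrow> 'w \<Rightarrow> real ^ 'd) \<Rightarrow>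
   ((real ^ 'n) \<times> 'c::euclidean_space \<Rightarrow> real ^ 'n) \<Rightarrow>
   ((real ^ 'n) \<times> 'c \<Rightarrow> real ^ 'd ^ 'n) \<Rightarrow> real ^ 'n \<Rightarrow>
   (real \<Rightarrow> 'w \<Rightarrow> 'c) \<Rightarrow> (real \<Rightarrow> 'w \<Rightarrow> real ^ 'n) \<Rightarrow> bool" where
  "strong_solution M T F W \<mu> \<sigma> x0 A X \<longleftrightarrow>
     adapted T F X \<and> continuous_paths M T X \<and>
     (AE \<omega> in M. X 0 \<omega> = x0) \<and>
     (AE \<omega> in M. set_integrable lborel {0..T} (\<lambda>s. \<mu> (X s \<omega>, A s \<omega>))) \<and>
     (\<exists>I. is_ito_integral M T F W (\<lambda>s \<omega>. \<sigma> (X s \<omega>, A s \<omega>)) I \<and>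
          (AE \<omega> in M. \<forall>t\<in>{0..T}.
             X t \<omega> = x0 + (LINT s:{0..t}|lborel. \<mu> (X s \<omega>, A s \<omega>)) + I t \<omega>))"

section \<open>The value function\<close>

definition value_function ::
  "'w measure \<Rightarrow> real \<Rightarrow> (real \<Rightarrow> 'w \<Rightarrow> 'c) set \<Rightarrow>
   ((real \<Rightarrow> 'w \<Rightarrow> 'c) \<Rightarrow> real \<Rightarrow> 'w \<Rightarrow> real ^ 'n) \<Rightarrow>
   (real \<times> (real ^ 'm) \<Rightarrow> real) \<Rightarrow> (real ^ 'n \<Rightarrow> real) \<Rightarrow> real ^ 'm \<Rightarrow> real" where
  "value_function M T \<A> X f g y = (INF A\<in>\<A>. (LINT \<omega>|M. f (g (X A T \<omega>), y)))"

end

theory Submission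
  imports Defs
begin

text \<open>
  The convexity of \<open>V\<close> is an infimum over convex combinations of controls; the work lies in showing
  that \<open>V\<close> is finite, for which \<open>E |X T|\<^sup>2\<close> has to be bounded uniformly over the controls.
  No stopping times or maximal inequalities are used. Let \<open>Q t\<close> be the integral of
  \<open>|H|\<^sup>2\<close> over \<open>[0,t]\<close>. For a simple integrand, \<open>Q\<close> at the end of a step is known at
  its beginning, so the integrand can be cut off, without losing adaptedness, before \<open>Q\<close> exceeds
  \<open>N\<close>; in the limit \<open>E[1{Q t < N} |I t|\<^sup>2] \<le> d E[min (Q t) N]\<close>. The right-hand side is bounded, hence
  an admissible quantity for Gronwall's inequality: a pathwise application bounds the truncated
  \<open>|X|\<^sup>2\<close> by the truncated \<open>|I|\<^sup>2\<close>, a second one bounds \<open>E[min (Q t) N]\<close> independently of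
  \<open>N\<close>, and \<open>N\<close> is sent to infinity.
\<close>

section \<open>Increments of Brownian motion\<close>

text \<open>\<open>LINT\<close> of a non-integrable function and \<open>INF\<close> of a set of
  reals unbounded below are default values, so convexity of V is meaningful only together with
  integrability and a lower bound; both come from the second moment. The obstacle is that
  \<open>strong_solution\<close> contains no moment condition, while Gronwall's inequality applies
  only to finite quantities. Hence everything is truncated on the event Q t < N. Since Q is
  nondecreasing, a path inside this event at time t was inside it at all earlier times, so the
  truncated processes satisfy integral inequalities of the same form. Q is the right quantity to
  truncate by: it controls I, and linear growth lets X control it in turn. The factor d replaces the
  constant 1 of the Ito isometry: |\<eta> D|^2 is estimated by |\<eta>|^2 |D|^2 in the Frobenius
  norm, and E|D|^2 is d times the elapsed time. An inequality is all that Gronwall's argument asks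
  for.\<close>

lemma norm_matrix_vector_mult_le:
  fixes A :: "real ^ 'd ^ 'n"
  shows "norm (A *v x) \<le> norm A * norm x"
proof -
  have "norm (A *v x) \<le> L2_set (\<lambda>i. norm (A $ i) * norm x) UNIV"
    unfolding norm_vec_def[of "A *v x"]
    by (rule L2_set_mono) (auto simp: matrix_vector_mul_component Cauchy_Schwarz_ineq2)
  also have "\<dots> = norm A * norm x"
    by (simp add: norm_vec_def[of A] L2_set_left_distrib)
  finally show ?thesis .
qed

locale brownian_filtration = prob_space M for M :: "'w measure" +
  fixes T :: real and F :: "real \<Rightarrow> 'w measure" and W :: "real \<Rightarrow> 'w \<Rightarrow> real ^ 'd"
  assumes usual: "usual_filtration M T F" and brownian: "brownian_motion M T F W"
begin

lemma subalgebra_F: "t \<in> {0..T} \<Longrightarrow> subalgebra M (F t)"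
  using usual by (auto simp: usual_filtration_def)

lemma subalgebra_F_mono: "0 \<le> s \<Longrightarrow> s \<le> t \<Longrightarrow> t \<le> T \<Longrightarrow> subalgebra (F t) (F s)"
  using usual subalgebra_F[of s] subalgebra_F[of t]
  by (auto simp: usual_filtration_def subalgebra_def)

lemma measurable_F_mono:
  "Z \<in> measurable (F s) N \<Longrightarrow> 0 \<le> s \<Longrightarrow> s \<le> t \<Longrightarrow> t \<le> T \<Longrightarrow> Z \<in> measurable (F t) N"
  using measurable_from_subalg[OF subalgebra_F_mono] by blast

lemma measurable_F_M: "Z \<in> measurable (F t) N \<Longrightarrow> t \<in> {0..T} \<Longrightarrow> Z \<in> measurable M N"
  using measurable_from_subalg[OF subalgebra_F] by blast

lemma W_measurable_F: "t \<in> {0..T} \<Longrightarrow> W t \<in> borel_measurable (F t)"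
  using brownian by (auto simp: brownian_motion_def adapted_def)

text \<open>\<open>brownian_motion\<close> states independence for the events of \<open>F s\<close>
  and the preimages under the increment. Both systems are closed under intersection, so independence
  passes to the sigma-algebras they generate and then to the smaller ones generated by
  \<open>Z\<close> and by \<open>\<phi>\<close> of the increment. \<open>\<phi>\<close> is later a
  coordinate or its square.\<close>

lemma indep_increment:
  fixes Z :: "'w \<Rightarrow> real" and \<phi> :: "real ^ 'd \<Rightarrow> real"
  assumes st: "0 \<le> s" "s < t" "t \<le> T"
    and Z: "Z \<in> borel_measurable (F s)" and \<phi>[measurable]: "\<phi> \<in> borel_measurable borel"
  shows "indep_var borel Z borel (\<lambda>\<omega>. \<phi> (W t \<omega> - W s \<omega>))"
proof -
  let ?D = "\<lambda>\<omega>. W t \<omega> - W s \<omega>"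
  let ?B = "{?D -` B \<inter> space M | B. B \<in> sets borel}"
  have ind: "indep_set (sets (F s)) ?B"
    using brownian st by (auto simp: brownian_motion_def)
  have [measurable]: "Z \<in> borel_measurable M" "W t \<in> borel_measurable M" "W s \<in> borel_measurable M"
    using st Z W_measurable_F[of s] W_measurable_F[of t] by (auto intro: measurable_F_M)
  have sp: "space (F s) = space M"
    using subalgebra_F[of s] st by (auto simp: subalgebra_def)
  have stab: "Int_stable ?B"
  proof (rule Int_stableI)
    fix a b assume "a \<in> ?B" "b \<in> ?B"
    then obtain A B where "A \<in> sets borel" "B \<in> sets borel" "a = ?D -` A \<inter> space M" "b = ?D -` B \<inter> space M"
      by auto
    then show "a \<inter> b \<in> ?B"
      by (auto intro!: exI[of _ "A \<inter> B"])
  qed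
  have "indep_set (sigma_sets (space M) (sets (F s))) (sigma_sets (space M) ?B)"
    using ind sets.Int_stable stab by (rule indep_set_sigma_sets)
  moreover have "sigma_sets (space M) {Z -` A \<inter> space M | A. A \<in> sets borel}
      \<subseteq> sigma_sets (space M) (sets (F s))"
    using measurable_sets[OF Z] sp by (intro sigma_sets_mono') auto
  moreover have "sigma_sets (space M) {(\<lambda>\<omega>. \<phi> (?D \<omega>)) -` A \<inter> space M | A. A \<in> sets borel}
      \<subseteq> sigma_sets (space M) ?B"
  proof (intro sigma_sets_mono' subsetI)
    fix a assume "a \<in> {(\<lambda>\<omega>. \<phi> (?D \<omega>)) -` A \<inter> space M | A. A \<in> sets borel}"
    then obtain A where "A \<in> sets borel" "a = (\<lambda>\<omega>. \<phi> (?D \<omega>)) -` A \<inter> space M" by auto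
    then show "a \<in> ?B"
      using measurable_sets[OF \<phi>, of A] by (auto intro!: exI[of _ "\<phi> -` A"])
  qed
  ultimately have "indep_set (sigma_sets (space M) {Z -` A \<inter> space M | A. A \<in> sets borel})
     (sigma_sets (space M) {(\<lambda>\<omega>. \<phi> (?D \<omega>)) -` A \<inter> space M | A. A \<in> sets borel})"
    unfolding indep_set_def by (elim indep_sets_mono_sets) (auto split: bool.split)
  then show ?thesis
    by (auto simp: indep_var_eq)
qed

lemma increment_component:
  assumes st: "0 \<le> s" "s < t" "t \<le> T"
  shows "integrable M (\<lambda>\<omega>. (W t \<omega> - W s \<omega>) $ i)" "expectation (\<lambda>\<omega>. (W t \<omega> - W s \<omega>) $ i) = 0"
    "integrable M (\<lambda>\<omega>. ((W t \<omega> - W s \<omega>) $ i)\<^sup>2)"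
    "expectation (\<lambda>\<omega>. ((W t \<omega> - W s \<omega>) $ i)\<^sup>2) = t - s"
proof -
  have D: "distributed M lborel (\<lambda>\<omega>. (W t \<omega> - W s \<omega>) $ i) (\<lambda>x. ennreal (normal_density 0 (sqrt (t - s)) x))"
    using brownian st by (auto simp: brownian_motion_def)
  have pos: "0 < sqrt (t - s)" using st by simp
  show "integrable M (\<lambda>\<omega>. (W t \<omega> - W s \<omega>) $ i)"
    using distributed_integrable[OF D, of "\<lambda>x. x"] integrable_normal_moment[OF pos, of 0 1] by simp
  show E: "expectation (\<lambda>\<omega>. (W t \<omega> - W s \<omega>) $ i) = 0"
    by (rule normal_distributed_expectation[OF pos D])
  show "integrable M (\<lambda>\<omega>. ((W t \<omega> - W s \<omega>) $ i)\<^sup>2)"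
    using distributed_integrable[OF D, of "\<lambda>x. x\<^sup>2"] integrable_normal_moment[OF pos, of 0 2] by simp
  show "expectation (\<lambda>\<omega>. ((W t \<omega> - W s \<omega>) $ i)\<^sup>2) = t - s"
    using normal_distributed_variance[OF pos D] E st by simp
qed

text \<open>Plays the part of conditioning on \<open>F s\<close>: a factor known at time s and a
  later increment are independent, so expectations of their products split. The factor
  \<open>CARD('d)\<close> counts the coordinates, each of variance t - s.\<close>

lemma integral_mult_increment:
  fixes Z :: "'w \<Rightarrow> real" and s t :: real
  assumes st: "0 \<le> s" "s \<le> t" "t \<le> T" and Z: "Z \<in> borel_measurable (F s)" "integrable M Z"
  shows "integrable M (\<lambda>\<omega>. Z \<omega> * (W t \<omega> - W s \<omega>) $ i)"
    "expectation (\<lambda>\<omega>. Z \<omega> * (W t \<omega> - W s \<omega>) $ i) = 0"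
    "integrable M (\<lambda>\<omega>. Z \<omega> * (norm (W t \<omega> - W s \<omega>))\<^sup>2)"
    "expectation (\<lambda>\<omega>. Z \<omega> * (norm (W t \<omega> - W s \<omega>))\<^sup>2) = CARD('d) * (t - s) * expectation Z"
proof -
  have "integrable M (\<lambda>\<omega>. Z \<omega> * (W t \<omega> - W s \<omega>) $ i) \<and>
    expectation (\<lambda>\<omega>. Z \<omega> * (W t \<omega> - W s \<omega>) $ i) = 0 \<and>
    integrable M (\<lambda>\<omega>. Z \<omega> * (norm (W t \<omega> - W s \<omega>))\<^sup>2) \<and>
    expectation (\<lambda>\<omega>. Z \<omega> * (norm (W t \<omega> - W s \<omega>))\<^sup>2) = CARD('d) * (t - s) * expectation Z"
  \<comment> \<open>\<open>brownian_motion\<close> speaks of s < t only. The degenerate case occurs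
    when a simple integral is evaluated at a partition point; the increment is then zero.\<close>
  proof (cases "s = t")
    case False
    then have st': "0 \<le> s" "s < t" "t \<le> T" using st by auto
    note c = increment_component[OF st']
    have i1: "indep_var borel Z borel (\<lambda>\<omega>. (W t \<omega> - W s \<omega>) $ i)"
      by (rule indep_increment[OF st' Z(1)]) simp
    have i2: "indep_var borel Z borel (\<lambda>\<omega>. ((W t \<omega> - W s \<omega>) $ j)\<^sup>2)" for j
      by (rule indep_increment[OF st' Z(1), of "\<lambda>x. (x $ j)\<^sup>2"]) simp
    have n: "Z \<omega> * (norm (W t \<omega> - W s \<omega>))\<^sup>2 = (\<Sum>j\<in>UNIV. Z \<omega> * ((W t \<omega> - W s \<omega>) $ j)\<^sup>2)" for \<omega>
      by (simp add: norm_vec_def L2_set_def sum_nonneg sum_distrib_left)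
    have int2: "integrable M (\<lambda>\<omega>. Z \<omega> * ((W t \<omega> - W s \<omega>) $ j)\<^sup>2)" for j
      by (rule indep_var_integrable[OF i2 Z(2) c(3)])
    have "expectation (\<lambda>\<omega>. Z \<omega> * ((W t \<omega> - W s \<omega>) $ j)\<^sup>2) = expectation Z * (t - s)" for j
      using indep_var_lebesgue_integral[OF i2[of j] Z(2) c(3)] c(4)[of j] by simp
    then show ?thesis
      unfolding n
      using indep_var_integrable[OF i1 Z(2) c(1)] indep_var_lebesgue_integral[OF i1 Z(2) c(1)] c(2) int2
      by (simp add: mult.commute)
  qed simp
  then show "integrable M (\<lambda>\<omega>. Z \<omega> * (W t \<omega> - W s \<omega>) $ i)"
    "expectation (\<lambda>\<omega>. Z \<omega> * (W t \<omega> - W s \<omega>) $ i) = 0"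
    "integrable M (\<lambda>\<omega>. Z \<omega> * (norm (W t \<omega> - W s \<omega>))\<^sup>2)"
    "expectation (\<lambda>\<omega>. Z \<omega> * (norm (W t \<omega> - W s \<omega>))\<^sup>2) = CARD('d) * (t - s) * expectation Z"
    by auto
qed

end

section \<open>Truncated second moments of Ito integrals\<close>

text \<open>The trace of the quadratic variation of the simple integral at time t. The difference of
  minima is the length of the part of a step lying before t; in this closed form measurability in
  (t, \<omega>) can be read off.\<close>

definition simple_qv :: "nat \<Rightarrow> (nat \<Rightarrow> real) \<Rightarrow> (nat \<Rightarrow> 'w \<Rightarrow> real ^ 'd ^ 'n) \<Rightarrow> real \<Rightarrow> 'w \<Rightarrow> real" where
  "simple_qv p \<tau> \<xi> t \<omega> = (\<Sum>i<p. (min t (\<tau> (Suc i)) - min t (\<tau> i)) * (norm (\<xi> i \<omega>))\<^sup>2)"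

lemma simple_integrand_mono:
  assumes "simple_integrand M T F p \<tau> \<xi>" "i \<le> j" "j \<le> p"
  shows "\<tau> i \<le> \<tau> j"
  using assms(2,3)
proof (induction j rule: dec_induct)
  case (step m)
  then have "\<tau> i \<le> \<tau> m" "\<tau> m < \<tau> (Suc m)"
    using assms(1) by (auto simp: simple_integrand_def)
  then show ?case by simp
qed simp

lemma simple_integrand_range:
  assumes "simple_integrand M T F p \<tau> \<xi>" "i \<le> p"
  shows "\<tau> i \<in> {0..T}"
  using simple_integrand_mono[OF assms(1), of 0 i] simple_integrand_mono[OF assms(1), of i p] assms
  by (auto simp: simple_integrand_def)

lemma borel_measurable_matrix_vector_mult[measurable (raw)]:
  fixes A :: "'a \<Rightarrow> real ^ 'd ^ 'n"
  assumes "A \<in> borel_measurable M" "x \<in> borel_measurable M"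
  shows "(\<lambda>\<omega>. A \<omega> *v x \<omega>) \<in> borel_measurable M"
  using assms
proof (rule borel_measurable_continuous_Pair)
  show "continuous_on UNIV (\<lambda>x :: (real ^ 'd ^ 'n) \<times> (real ^ 'd). fst x *v snd x)"
    unfolding matrix_vector_mult_def by (intro continuous_intros)
qed

text \<open>Splits the cross term of a squared sum into columns: in each summand the first factor is
  a scalar known at the beginning of the step and the second a single coordinate of the increment,
  as \<open>integral_mult_increment\<close> requires.\<close>

lemma inner_matrix_vector_mult:
  fixes A :: "real ^ 'd ^ 'n"
  shows "x \<bullet> (A *v y) = (\<Sum>c\<in>UNIV. (x \<bullet> (A *v axis c 1)) * y $ c)"
proof -
  have "x \<bullet> (A *v axis c 1) = (x v* A) $ c" for c
    by (simp flip: dot_lmul_matrix add: inner_axis)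
  moreover have "x \<bullet> (A *v y) = (x v* A) \<bullet> y"
    by (simp add: dot_lmul_matrix)
  ultimately show ?thesis
    by (simp add: inner_vec_def[of "x v* A"])
qed

context brownian_filtration
begin

text \<open>Expand the square. The cross term has mean zero because its coefficients
  \<open>Z c\<close> are known at time s and the increment is centred and independent; the last term
  is at most the product of the squared norms, whose expectation factorises. Boundedness of
  \<open>\<eta>\<close> makes the \<open>Z c\<close> integrable.\<close>

lemma second_moment_step:
  fixes S :: "'w \<Rightarrow> real ^ 'n" and \<eta> :: "'w \<Rightarrow> real ^ 'd ^ 'n" and s t B :: real
  assumes st: "0 \<le> s" "s \<le> t" "t \<le> T"
    and S: "S \<in> borel_measurable (F s)" "integrable M (\<lambda>\<omega>. (norm (S \<omega>))\<^sup>2)"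
    and \<eta>: "\<eta> \<in> borel_measurable (F s)" "\<And>\<omega>. \<omega> \<in> space M \<Longrightarrow> norm (\<eta> \<omega>) \<le> B"
  defines "S' \<equiv> \<lambda>\<omega>. S \<omega> + \<eta> \<omega> *v (W t \<omega> - W s \<omega>)"
  shows "integrable M (\<lambda>\<omega>. (norm (S' \<omega>))\<^sup>2)"
    and "expectation (\<lambda>\<omega>. (norm (S' \<omega>))\<^sup>2) \<le> expectation (\<lambda>\<omega>. (norm (S \<omega>))\<^sup>2)
           + CARD('d) * (t - s) * expectation (\<lambda>\<omega>. (norm (\<eta> \<omega>))\<^sup>2)"
proof -
  let ?D = "\<lambda>\<omega>. W t \<omega> - W s \<omega>"
  define Z where "Z c \<omega> = S \<omega> \<bullet> (\<eta> \<omega> *v axis c 1)" for c \<omega>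
  have [measurable]: "S \<in> borel_measurable M" "\<eta> \<in> borel_measurable M"
    "W t \<in> borel_measurable M" "W s \<in> borel_measurable M"
    using st S \<eta> W_measurable_F[of s] W_measurable_F[of t] by (auto intro: measurable_F_M)
  have Z_F: "Z c \<in> borel_measurable (F s)" for c
    unfolding Z_def using S(1) \<eta>(1) by measurable
  have Z_int: "integrable M (Z c)" for c
  proof (rule Bochner_Integration.integrable_bound)
    show "integrable M (\<lambda>\<omega>. B * (1 + (norm (S \<omega>))\<^sup>2))"
      using S(2) by simp
    show "Z c \<in> borel_measurable M"
      unfolding Z_def by measurable
    show "AE \<omega> in M. norm (Z c \<omega>) \<le> norm (B * (1 + (norm (S \<omega>))\<^sup>2))"
    proof (rule AE_I2)
      fix \<omega> assume "\<omega> \<in> space M"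
      then have B: "norm (\<eta> \<omega>) \<le> B" by (rule \<eta>(2))
      have "norm (Z c \<omega>) \<le> norm (S \<omega>) * norm (\<eta> \<omega> *v axis c 1)"
        unfolding Z_def by (metis Cauchy_Schwarz_ineq2 real_norm_def)
      also have "\<dots> \<le> norm (S \<omega>) * norm (\<eta> \<omega>)"
        using norm_matrix_vector_mult_le[of "\<eta> \<omega>" "axis c 1"] by (auto intro: mult_left_mono)
      also have "\<dots> \<le> (1 + (norm (S \<omega>))\<^sup>2) * B"
      proof (rule mult_mono[OF _ B])
        show "norm (S \<omega>) \<le> 1 + (norm (S \<omega>))\<^sup>2"
          using zero_le_power2[of "norm (S \<omega>) - 1"] norm_ge_zero[of "S \<omega>"]
          by (simp add: power2_diff del: norm_ge_zero zero_le_power2)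
      qed auto
      finally show "norm (Z c \<omega>) \<le> norm (B * (1 + (norm (S \<omega>))\<^sup>2))"
        by (simp add: mult.commute)
    qed
  qed
  have \<eta>2_F: "(\<lambda>\<omega>. (norm (\<eta> \<omega>))\<^sup>2) \<in> borel_measurable (F s)"
    using \<eta>(1) by measurable
  have \<eta>2_int: "integrable M (\<lambda>\<omega>. (norm (\<eta> \<omega>))\<^sup>2)"
    by (rule integrable_const_bound[of _ "B\<^sup>2"]) (auto intro!: AE_I2 power_mono \<eta>(2))
  note q = integral_mult_increment[OF st \<eta>2_F \<eta>2_int]
  note c = integral_mult_increment(1,2)[OF st Z_F Z_int]
  define G where "G \<omega> = (norm (S \<omega>))\<^sup>2 + 2 * (\<Sum>c\<in>UNIV. Z c \<omega> * ?D \<omega> $ c) + (norm (\<eta> \<omega>))\<^sup>2 * (norm (?D \<omega>))\<^sup>2" for \<omega>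
  have G_int: "integrable M G"
    unfolding G_def using S(2) c(1) q(3) by auto
  have G_exp: "expectation G = expectation (\<lambda>\<omega>. (norm (S \<omega>))\<^sup>2)
      + CARD('d) * (t - s) * expectation (\<lambda>\<omega>. (norm (\<eta> \<omega>))\<^sup>2)"
    unfolding G_def using S(2) c q(3,4) by simp
  have le: "(norm (S' \<omega>))\<^sup>2 \<le> G \<omega>" for \<omega>
  proof -
    have "(norm (S' \<omega>))\<^sup>2 = (norm (S \<omega>))\<^sup>2 + 2 * (S \<omega> \<bullet> (\<eta> \<omega> *v ?D \<omega>)) + (norm (\<eta> \<omega> *v ?D \<omega>))\<^sup>2"
      by (simp add: S'_def power2_norm_eq_inner inner_add inner_commute)
    moreover have "(norm (\<eta> \<omega> *v ?D \<omega>))\<^sup>2 \<le> (norm (\<eta> \<omega>))\<^sup>2 * (norm (?D \<omega>))\<^sup>2"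
      by (metis norm_matrix_vector_mult_le norm_ge_zero power_mono power_mult_distrib)
    ultimately show ?thesis
      by (simp add: G_def Z_def inner_matrix_vector_mult[of "S \<omega>" "\<eta> \<omega>" "?D \<omega>"])
  qed
  show *: "integrable M (\<lambda>\<omega>. (norm (S' \<omega>))\<^sup>2)"
  proof (rule Bochner_Integration.integrable_bound[OF G_int])
    show "(\<lambda>\<omega>. (norm (S' \<omega>))\<^sup>2) \<in> borel_measurable M"
      unfolding S'_def by measurable
    show "AE \<omega> in M. norm ((norm (S' \<omega>))\<^sup>2) \<le> norm (G \<omega>)"
      using le by (intro AE_I2) (smt (verit) real_norm_def zero_le_power2)
  qed
  show "expectation (\<lambda>\<omega>. (norm (S' \<omega>))\<^sup>2) \<le> expectation (\<lambda>\<omega>. (norm (S \<omega>))\<^sup>2)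
           + CARD('d) * (t - s) * expectation (\<lambda>\<omega>. (norm (\<eta> \<omega>))\<^sup>2)"
    unfolding G_exp[symmetric] by (rule integral_mono[OF * G_int le])
qed

text \<open>Where \<open>simple_qv\<close> is at most N, the cut-off integrand \<open>\<eta>\<close>
  agrees with \<open>\<xi>\<close>, so the left-hand side is at most the second moment of the
  cut-off sum \<open>S p\<close>. That moment is at most d times the expectation of
  \<open>R p\<close>, and \<open>R p\<close> lies below both \<open>cum p\<close> and N.\<close>

lemma simple_integral_second_moment:
  fixes \<xi> :: "nat \<Rightarrow> 'w \<Rightarrow> real ^ 'd ^ 'n"
  assumes sp: "simple_integrand M T F p \<tau> \<xi>" and t: "t \<in> {0..T}" and N: "0 \<le> N"
  shows "(\<integral>\<^sup>+\<omega>. ennreal (indicator {x. simple_qv p \<tau> \<xi> t x \<le> N} \<omega> * (norm (simple_integral W p \<tau> \<xi> t \<omega>))\<^sup>2) \<partial>M)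
      \<le> CARD('d) * (\<integral>\<^sup>+\<omega>. ennreal (min (simple_qv p \<tau> \<xi> t \<omega>) N) \<partial>M)"
proof -
  define \<Delta> where "\<Delta> i = min t (\<tau> (Suc i)) - min t (\<tau> i)" for i
  define cum where "cum i \<omega> = (\<Sum>j<i. \<Delta> j * (norm (\<xi> j \<omega>))\<^sup>2)" for i \<omega>
  \<comment> \<open>\<open>cum (Suc i)\<close>, and not only \<open>cum i\<close>, is known at time \<open>\<tau> i\<close>: the cut-off sum never overshoots \<open>N\<close>.\<close>
  define \<eta> where "\<eta> i \<omega> = (if cum (Suc i) \<omega> \<le> N then \<xi> i \<omega> else 0)" for i \<omega>
  define S where "S i \<omega> = (\<Sum>j<i. \<eta> j \<omega> *v (W (min t (\<tau> (Suc j))) \<omega> - W (min t (\<tau> j)) \<omega>))" for i \<omega>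
  define R where "R i \<omega> = (\<Sum>j<i. \<Delta> j * (norm (\<eta> j \<omega>))\<^sup>2)" for i \<omega>
  have \<tau>: "\<tau> i \<in> {0..T}" if "i \<le> p" for i
    using simple_integrand_range[OF sp that] .
  have \<tau>_Suc: "\<tau> i < \<tau> (Suc i)" if "i < p" for i
    using sp that by (auto simp: simple_integrand_def)
  have \<Delta>_nonneg: "0 \<le> \<Delta> i" if "i < p" for i
    using \<tau>_Suc[OF that] by (auto simp: \<Delta>_def)
  have \<xi>_meas: "\<xi> i \<in> borel_measurable (F (\<tau> j))" if "i \<le> j" "j \<le> p" "i < p" for i j
  proof (rule measurable_F_mono)
    show "\<xi> i \<in> borel_measurable (F (\<tau> i))"
      using sp that by (simp add: simple_integrand_def)
  qed (use simple_integrand_mono[OF sp that(1,2)] \<tau>[of i] \<tau>[of j] that in auto)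
  have \<xi>_M[measurable]: "\<xi> i \<in> borel_measurable M" if "i < p" for i
    using measurable_F_M[OF \<xi>_meas[of i i] \<tau>[of i]] that by simp
  have cum_meas: "cum (Suc i) \<in> borel_measurable (F (\<tau> j))" if "i \<le> j" "j \<le> p" "i < p" for i j
    unfolding cum_def
    by (intro borel_measurable_sum borel_measurable_times borel_measurable_const
        borel_measurable_power measurable_compose[OF _ borel_measurable_norm] \<xi>_meas) (use that in auto)
  have \<eta>_meas: "\<eta> i \<in> borel_measurable (F (\<tau> j))" if "i \<le> j" "j \<le> p" "i < p" for i j
  proof -
    note [measurable] = cum_meas[OF that] \<xi>_meas[OF that]
    show ?thesis unfolding \<eta>_def by measurable
  qed
  have W_meas: "W (min t (\<tau> i)) \<in> borel_measurable (F (\<tau> j))" if "i \<le> j" "j \<le> p" for i j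
    using \<tau>[of i] \<tau>[of j] simple_integrand_mono[OF sp that] t that
    by (intro measurable_F_mono[OF W_measurable_F, of "min t (\<tau> i)"]) auto
  have S_meas: "S i \<in> borel_measurable (F (\<tau> i))" if "i \<le> p" for i
  proof -
    have "(\<lambda>\<omega>. \<eta> j \<omega> *v (W (min t (\<tau> (Suc j))) \<omega> - W (min t (\<tau> j)) \<omega>)) \<in> borel_measurable (F (\<tau> i))"
      if "j < i" for j
    proof -
      have "\<eta> j \<in> borel_measurable (F (\<tau> i))" "W (min t (\<tau> (Suc j))) \<in> borel_measurable (F (\<tau> i))"
        "W (min t (\<tau> j)) \<in> borel_measurable (F (\<tau> i))"
        using that \<open>i \<le> p\<close> by (auto intro!: \<eta>_meas W_meas)
      then show ?thesis
        by (intro borel_measurable_matrix_vector_mult borel_measurable_diff)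
    qed
    then show ?thesis unfolding S_def by (auto intro: borel_measurable_sum)
  qed
  have bdd: "\<exists>B. \<forall>\<omega>\<in>space M. norm (\<eta> i \<omega>) \<le> B" if "i < p" for i
  proof -
    have "bounded (\<xi> i ` space M)" using sp that by (auto simp: simple_integrand_def)
    then obtain B where "\<forall>x\<in>\<xi> i ` space M. norm x \<le> B" by (auto simp: bounded_iff)
    then show ?thesis
      by (intro exI[of _ "max B 0"]) (auto simp: \<eta>_def le_max_iff_disj)
  qed
  have \<eta>2_int: "integrable M (\<lambda>\<omega>. (norm (\<eta> i \<omega>))\<^sup>2)" if i: "i < p" for i
  proof -
    obtain B where "\<forall>\<omega>\<in>space M. norm (\<eta> i \<omega>) \<le> B" using bdd[OF i] by blast
    then have "AE \<omega> in M. norm ((norm (\<eta> i \<omega>))\<^sup>2) \<le> B\<^sup>2"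
      by (auto intro!: AE_I2 power_mono)
    moreover have "\<eta> i \<in> borel_measurable M"
      using measurable_F_M[OF \<eta>_meas[of i i] \<tau>[of i]] i by simp
    ultimately show ?thesis
      by (intro integrable_const_bound[of _ "B\<^sup>2"]) auto
  qed
  have step: "integrable M (\<lambda>\<omega>. (norm (S i \<omega>))\<^sup>2) \<and>
      expectation (\<lambda>\<omega>. (norm (S i \<omega>))\<^sup>2) \<le> CARD('d) * expectation (R i)" if "i \<le> p" for i
    using that
  proof (induction i)
    case 0
    then show ?case by (simp add: S_def R_def)
  next
    case (Suc i)
    then have ip: "i < p" by simp
    have IH: "integrable M (\<lambda>\<omega>. (norm (S i \<omega>))\<^sup>2)"
      "expectation (\<lambda>\<omega>. (norm (S i \<omega>))\<^sup>2) \<le> CARD('d) * expectation (R i)"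
      using Suc.IH ip by auto
    have S_Suc: "S (Suc i) = (\<lambda>\<omega>. S i \<omega> + \<eta> i \<omega> *v (W (min t (\<tau> (Suc i))) \<omega> - W (min t (\<tau> i)) \<omega>))"
      by (simp add: S_def fun_eq_iff)
    have R_int: "integrable M (R j)" if "j \<le> p" for j
      unfolding R_def using that \<eta>2_int by auto
    have R_Suc: "expectation (R (Suc i)) = expectation (R i) + \<Delta> i * expectation (\<lambda>\<omega>. (norm (\<eta> i \<omega>))\<^sup>2)"
    proof -
      have "R (Suc i) = (\<lambda>\<omega>. R i \<omega> + \<Delta> i * (norm (\<eta> i \<omega>))\<^sup>2)"
        by (simp add: R_def fun_eq_iff)
      then show ?thesis
        using R_int[of i] \<eta>2_int[OF ip] ip by simp
    qed
    obtain B where B: "\<And>\<omega>. \<omega> \<in> space M \<Longrightarrow> norm (\<eta> i \<omega>) \<le> B" using bdd[OF ip] by blast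
    show ?case
    \<comment> \<open>Up to t the step starts at \<open>\<tau> i\<close>, where \<open>S i\<close>
      and \<open>\<eta> i\<close> are known, and \<open>second_moment_step\<close> applies. Past t
      both endpoints collapse to t and the step adds nothing to either side.\<close>
    proof (cases "\<tau> i \<le> t")
      case True
      then have m: "min t (\<tau> i) = \<tau> i" by simp
      have ord: "0 \<le> \<tau> i" "\<tau> i \<le> min t (\<tau> (Suc i))" "min t (\<tau> (Suc i)) \<le> T"
        using True t \<tau>[of i] \<tau>_Suc[OF ip] ip by auto
      have \<eta>i: "\<eta> i \<in> borel_measurable (F (\<tau> i))" using \<eta>_meas[of i i] ip by simp
      note s = second_moment_step[OF ord S_meas IH(1) \<eta>i B]
      have "integrable M (\<lambda>\<omega>. (norm (S (Suc i) \<omega>))\<^sup>2)"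
        unfolding S_Suc m using s(1) ip by simp
      moreover have "expectation (\<lambda>\<omega>. (norm (S (Suc i) \<omega>))\<^sup>2) \<le>
          expectation (\<lambda>\<omega>. (norm (S i \<omega>))\<^sup>2) + CARD('d) * \<Delta> i * expectation (\<lambda>\<omega>. (norm (\<eta> i \<omega>))\<^sup>2)"
        unfolding S_Suc \<Delta>_def m using s(2) ip by simp
      ultimately show ?thesis
        unfolding R_Suc using IH(2) by (simp add: algebra_simps)
    next
      case False
      then have "min t (\<tau> i) = t" "min t (\<tau> (Suc i)) = t"
        using \<tau>_Suc[OF ip] by auto
      then show ?thesis
        using IH R_Suc by (simp add: S_Suc \<Delta>_def)
    qed
  qed
  have cum_mono: "cum i \<omega> \<le> cum j \<omega>" if "i \<le> j" "j \<le> p" for i j \<omega>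
    unfolding cum_def using that \<Delta>_nonneg by (intro sum_mono2) auto
  have R_cum: "R i \<omega> \<le> cum i \<omega>" if "i \<le> p" for i \<omega>
    unfolding R_def cum_def using that \<Delta>_nonneg
    by (intro sum_mono mult_left_mono power_mono) (auto simp: \<eta>_def)
  \<comment> \<open>Once \<open>cum (Suc i)\<close> exceeds N, \<open>\<eta> i\<close> vanishes and
    \<open>R\<close> stops growing; before that, \<open>R\<close> is dominated by
    \<open>cum\<close>.\<close>
  have R_N: "R i \<omega> \<le> N" if "i \<le> p" for i \<omega>
    using that
  proof (induction i)
    case (Suc i)
    show ?case
    proof (cases "cum (Suc i) \<omega> \<le> N")
      case True
      then show ?thesis using R_cum[OF Suc.prems, of \<omega>] by simp
    next
      case False
      then have "\<eta> i \<omega> = 0" by (simp add: \<eta>_def)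
      then show ?thesis using Suc by (simp add: R_def)
    qed
  qed (simp add: R_def N)
  have qv: "simple_qv p \<tau> \<xi> t \<omega> = cum p \<omega>" for \<omega>
    by (simp add: simple_qv_def cum_def \<Delta>_def)
  have R_nonneg: "0 \<le> R p \<omega>" for \<omega>
    unfolding R_def using \<Delta>_nonneg by (auto intro!: sum_nonneg)
  have R_int: "integrable M (R p)"
    unfolding R_def using \<eta>2_int by auto
  have "(\<integral>\<^sup>+\<omega>. ennreal (indicator {x. simple_qv p \<tau> \<xi> t x \<le> N} \<omega> * (norm (simple_integral W p \<tau> \<xi> t \<omega>))\<^sup>2) \<partial>M)
     \<le> (\<integral>\<^sup>+\<omega>. ennreal ((norm (S p \<omega>))\<^sup>2) \<partial>M)"
  proof (intro nn_integral_mono ennreal_leI)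
    fix \<omega>
    show "indicator {x. simple_qv p \<tau> \<xi> t x \<le> N} \<omega> * (norm (simple_integral W p \<tau> \<xi> t \<omega>))\<^sup>2 \<le> (norm (S p \<omega>))\<^sup>2"
    proof (cases "cum p \<omega> \<le> N")
      case True
      then have "\<eta> j \<omega> = \<xi> j \<omega>" if "j < p" for j
        using cum_mono[of "Suc j" p \<omega>] that by (simp add: \<eta>_def)
      then show ?thesis
        using True by (simp add: qv S_def simple_integral_def)
    qed (simp add: qv)
  qed
  also have "\<dots> = ennreal (expectation (\<lambda>\<omega>. (norm (S p \<omega>))\<^sup>2))"
    using step[of p] by (intro nn_integral_eq_integral) auto
  also have "\<dots> \<le> ennreal (CARD('d) * expectation (R p))"
    using step[of p] by (intro ennreal_leI) auto
  also have "\<dots> = CARD('d) * (\<integral>\<^sup>+\<omega>. ennreal (R p \<omega>) \<partial>M)"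
    using R_nonneg by (simp add: nn_integral_eq_integral[OF R_int] ennreal_mult' ennreal_of_nat_eq_real_of_nat)
  also have "\<dots> \<le> CARD('d) * (\<integral>\<^sup>+\<omega>. ennreal (min (simple_qv p \<tau> \<xi> t \<omega>) N) \<partial>M)"
    using R_N[of p] R_cum[of p] by (intro mult_left_mono nn_integral_mono ennreal_leI) (auto simp: qv)
  finally show ?thesis .
qed

end

section \<open>Convergence in probability\<close>

text \<open>The distance truncated at 1 is bounded, so convergence in probability becomes
  convergence of \<open>u\<close> to 0 in L1, for which an almost surely convergent subsequence
  exists. Once \<open>u\<close> is below 1 the truncation is inactive and the distance itself tends
  to 0.\<close>

lemma (in prob_space) tendsto_in_probability_AE_subseq:
  fixes Y :: "nat \<Rightarrow> 'a \<Rightarrow> 'b::{metric_space, second_countable_topology}"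
  assumes "tendsto_in_probability M Y Z"
  shows "\<exists>r. strict_mono r \<and> (AE \<omega> in M. (\<lambda>k. Y (r k) \<omega>) \<longlonglongrightarrow> Z \<omega>)"
proof -
  have [measurable]: "\<And>k. Y k \<in> borel_measurable M" "Z \<in> borel_measurable M"
    and lim: "\<And>\<epsilon>. 0 < \<epsilon> \<Longrightarrow> (\<lambda>k. prob {\<omega> \<in> space M. \<epsilon> < dist (Y k \<omega>) (Z \<omega>)}) \<longlonglongrightarrow> 0"
    using assms by (auto simp: tendsto_in_probability_def)
  define u where "u k \<omega> = min 1 (dist (Y k \<omega>) (Z \<omega>))" for k \<omega>
  have [measurable]: "u k \<in> borel_measurable M" for k
    unfolding u_def by measurable
  have u_int: "integrable M (u k)" for k
    by (rule integrable_const_bound[of _ 1]) (auto simp: u_def)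
  have bound: "expectation (\<lambda>\<omega>. norm (u k \<omega>)) \<le> \<epsilon> + prob {\<omega> \<in> space M. \<epsilon> < dist (Y k \<omega>) (Z \<omega>)}"
    if "0 < \<epsilon>" for k \<epsilon>
  proof -
    let ?A = "{\<omega> \<in> space M. \<epsilon> < dist (Y k \<omega>) (Z \<omega>)}"
    have [measurable]: "?A \<in> events" by measurable
    have "expectation (\<lambda>\<omega>. norm (u k \<omega>)) \<le> expectation (\<lambda>\<omega>. \<epsilon> + indicator ?A \<omega>)"
    proof (rule integral_mono)
      show "integrable M (\<lambda>\<omega>. norm (u k \<omega>))"
        using u_int by simp
      show "integrable M (\<lambda>\<omega>. \<epsilon> + indicator ?A \<omega> :: real)"
        by (intro Bochner_Integration.integrable_add integrable_real_indicator) (auto simp: emeasure_eq_measure)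
    qed (use that in \<open>auto simp: u_def indicator_def\<close>)
    also have "\<dots> = \<epsilon> + prob ?A"
      by (subst Bochner_Integration.integral_add)
        (auto simp: prob_space emeasure_eq_measure Int_absorb2 Collect_restrict intro!: integrable_real_indicator)
    finally show ?thesis .
  qed
  have "(\<lambda>k. expectation (\<lambda>\<omega>. norm (u k \<omega>))) \<longlonglongrightarrow> 0"
  proof (rule LIMSEQ_I)
    fix e :: real assume "0 < e"
    then have "eventually (\<lambda>k. prob {\<omega> \<in> space M. e / 2 < dist (Y k \<omega>) (Z \<omega>)} < e / 2) sequentially"
      by (intro order_tendstoD(2)[OF lim]) auto
    then have "eventually (\<lambda>k. norm (expectation (\<lambda>\<omega>. norm (u k \<omega>)) - 0) < e) sequentially"
    proof eventually_elim
      case (elim k)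
      have "0 \<le> expectation (\<lambda>\<omega>. norm (u k \<omega>))" by simp
      then show ?case
        using elim bound[of "e / 2" k] \<open>0 < e\<close> by simp
    qed
    then show "\<exists>no. \<forall>n\<ge>no. norm (expectation (\<lambda>\<omega>. norm (u n \<omega>)) - 0) < e"
      by (simp add: eventually_sequentially)
  qed
  then obtain r where r: "strict_mono r" "AE \<omega> in M. (\<lambda>k. u (r k) \<omega>) \<longlonglongrightarrow> 0"
    using tendsto_L1_AE_subseq[of M u, OF u_int] by blast
  from r(2) have "AE \<omega> in M. (\<lambda>k. Y (r k) \<omega>) \<longlonglongrightarrow> Z \<omega>"
  proof eventually_elim
    case (elim \<omega>)
    then have "eventually (\<lambda>k. u (r k) \<omega> < 1) sequentially"
      by (rule order_tendstoD) simp
    then have "eventually (\<lambda>k. u (r k) \<omega> = dist (Y (r k) \<omega>) (Z \<omega>)) sequentially"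
      by eventually_elim (auto simp: u_def min_def split: if_splits)
    then show ?case
      using elim unfolding tendsto_dist_iff[of _ "Z \<omega>"]
      by (rule Lim_transform_eventually[rotated])
  qed
  with r(1) show ?thesis by blast
qed

lemma tendsto_in_probability_subseq:
  assumes "tendsto_in_probability M Y Z" "strict_mono r"
  shows "tendsto_in_probability M (\<lambda>k. Y (r k)) Z"
  using assms LIMSEQ_subseq_LIMSEQ[OF _ assms(2)]
  by (auto simp: tendsto_in_probability_def comp_def)

section \<open>Square integrals of simple processes and their limits\<close>

text \<open>The partition intervals are disjoint, so at every time at most one summand is nonzero
  and the square produces no cross terms.\<close>

lemma norm_simple_process:
  fixes \<xi> :: "nat \<Rightarrow> 'w \<Rightarrow> real ^ 'd ^ 'n"
  assumes sp: "simple_integrand M T F p \<tau> \<xi>"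
  shows "(norm (simple_process p \<tau> \<xi> s \<omega>))\<^sup>2 =
    (\<Sum>i<p. indicator {\<tau> i<..\<tau> (Suc i)} s * (norm (\<xi> i \<omega>))\<^sup>2)"
proof (cases "\<exists>i<p. s \<in> {\<tau> i<..\<tau> (Suc i)}")
  case True
  then obtain i where i: "i < p" "s \<in> {\<tau> i<..\<tau> (Suc i)}" by blast
  have ind: "indicator {\<tau> j<..\<tau> (Suc j)} s = (if j = i then 1 else 0 :: real)" if "j < p" for j
  proof (cases j i rule: linorder_cases)
    case less
    then show ?thesis
      using simple_integrand_mono[OF sp, of "Suc j" i] i by (auto simp: indicator_def)
  next
    case greater
    then show ?thesis
      using simple_integrand_mono[OF sp, of "Suc i" j] i that by (auto simp: indicator_def)
  qed (use i in \<open>auto simp: indicator_def\<close>)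
  have "simple_process p \<tau> \<xi> s \<omega> = (\<Sum>j<p. if j = i then \<xi> i \<omega> else 0)"
    unfolding simple_process_def using ind by (intro sum.cong) auto
  moreover have "(\<Sum>j<p. indicator {\<tau> j<..\<tau> (Suc j)} s * (norm (\<xi> j \<omega>))\<^sup>2) =
      (\<Sum>j<p. if j = i then (norm (\<xi> i \<omega>))\<^sup>2 else 0)"
    using ind by (intro sum.cong) auto
  ultimately show ?thesis
    using i by simp
next
  case False
  then have "indicator {\<tau> j<..\<tau> (Suc j)} s = (0 :: real)" if "j < p" for j
    using that by (simp add: indicator_def)
  then show ?thesis
    by (simp add: simple_process_def)
qed

lemma borel_measurable_simple_process[measurable]:
  "(\<lambda>s. simple_process p \<tau> \<xi> s \<omega>) \<in> borel_measurable borel"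
  unfolding simple_process_def by measurable

text \<open>Connects the closed form \<open>simple_qv\<close> with the approximation demanded in
  \<open>is_ito_integral\<close>: through it, convergence of integrands becomes convergence of
  \<open>simple_qv\<close>.\<close>

lemma square_integral_simple_process:
  fixes \<xi> :: "nat \<Rightarrow> 'w \<Rightarrow> real ^ 'd ^ 'n"
  assumes sp: "simple_integrand M T F p \<tau> \<xi>" and t: "0 \<le> t"
  shows "set_integrable lborel {0..t} (\<lambda>s. (norm (simple_process p \<tau> \<xi> s \<omega>))\<^sup>2)"
    and "(LINT s:{0..t}|lborel. (norm (simple_process p \<tau> \<xi> s \<omega>))\<^sup>2) = simple_qv p \<tau> \<xi> t \<omega>"
proof -
  have *: "has_bochner_integral lborel (\<lambda>s. indicator {\<tau> i<..\<tau> (Suc i)} s * indicator {0..t} s :: real)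
     (min t (\<tau> (Suc i)) - min t (\<tau> i))" if "i < p" for i
  proof -
    have "\<tau> i \<in> {0..T}" "\<tau> i < \<tau> (Suc i)"
      using simple_integrand_range[OF sp, of i] sp that by (auto simp: simple_integrand_def)
    then have eq: "(\<lambda>s. indicator {\<tau> i<..\<tau> (Suc i)} s * indicator {0..t} s :: real) =
        indicator {min t (\<tau> i)<..min t (\<tau> (Suc i))}"
      by (auto simp: indicator_def fun_eq_iff)
    have "has_bochner_integral lborel (indicator {min t (\<tau> i)<..min t (\<tau> (Suc i))})
        (measure lborel {min t (\<tau> i)<..min t (\<tau> (Suc i))})"
      using \<open>\<tau> i < \<tau> (Suc i)\<close>
      by (intro has_bochner_integral_real_indicator) (auto simp: emeasure_lborel_Ioc)
    then show ?thesis
      using \<open>\<tau> i < \<tau> (Suc i)\<close> unfolding eq by simp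
  qed
  have "has_bochner_integral lborel
      (\<lambda>s. \<Sum>i<p. indicator {\<tau> i<..\<tau> (Suc i)} s * indicator {0..t} s * (norm (\<xi> i \<omega>))\<^sup>2)
      (simple_qv p \<tau> \<xi> t \<omega>)"
    unfolding simple_qv_def
    by (intro has_bochner_integral_sum has_bochner_integral_mult_left *) auto
  moreover have "(\<lambda>s. \<Sum>i<p. indicator {\<tau> i<..\<tau> (Suc i)} s * indicator {0..t} s * (norm (\<xi> i \<omega>))\<^sup>2) =
      (\<lambda>s. indicator {0..t} s *\<^sub>R (norm (simple_process p \<tau> \<xi> s \<omega>))\<^sup>2)"
    by (simp add: norm_simple_process[OF sp] sum_distrib_left fun_eq_iff ac_simps)
  ultimately have "has_bochner_integral lborel
      (\<lambda>s. indicator {0..t} s *\<^sub>R (norm (simple_process p \<tau> \<xi> s \<omega>))\<^sup>2) (simple_qv p \<tau> \<xi> t \<omega>)"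
    by simp
  then show "set_integrable lborel {0..t} (\<lambda>s. (norm (simple_process p \<tau> \<xi> s \<omega>))\<^sup>2)"
    and "(LINT s:{0..t}|lborel. (norm (simple_process p \<tau> \<xi> s \<omega>))\<^sup>2) = simple_qv p \<tau> \<xi> t \<omega>"
    unfolding set_integrable_def set_lebesgue_integral_def
    by (auto dest: integrable.intros has_bochner_integral_integral_eq)
qed

text \<open>Young's inequality 2ab \<le> a^2/e + e b^2 bounds the difference of the squared norms
  pointwise by a large multiple of |g - h|^2 plus a small multiple of |h|^2. After integration the
  first part vanishes in the limit for fixed e, and e is arbitrary.\<close>

lemma square_integral_tendsto:
  fixes g :: "nat \<Rightarrow> real \<Rightarrow> 'b::euclidean_space" and h :: "real \<Rightarrow> 'b"
  assumes g_meas[measurable]: "\<And>k. g k \<in> borel_measurable borel"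
    and g: "\<And>k. set_integrable lborel {0..T} (\<lambda>s. (norm (g k s))\<^sup>2)"
    and h_meas: "set_borel_measurable lborel {0..T} h"
    and h: "set_integrable lborel {0..T} (\<lambda>s. (norm (h s))\<^sup>2)"
    and lim: "(\<lambda>k. LINT s:{0..T}|lborel. (norm (g k s - h s))\<^sup>2) \<longlonglongrightarrow> 0"
    and t: "t \<in> {0..T}"
  shows "(\<lambda>k. LINT s:{0..t}|lborel. (norm (g k s))\<^sup>2) \<longlonglongrightarrow> (LINT s:{0..t}|lborel. (norm (h s))\<^sup>2)"
proof -
  define A where "A = (LINT s:{0..T}|lborel. (norm (h s))\<^sup>2)"
  define D where "D k = (LINT s:{0..T}|lborel. (norm (g k s - h s))\<^sup>2)" for k
  let ?h = "\<lambda>s. indicator {0..T} s *\<^sub>R h s"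
  have [measurable]: "?h \<in> borel_measurable borel"
    using h_meas by (simp add: set_borel_measurable_def)
  have A_nonneg: "0 \<le> A"
    unfolding A_def set_lebesgue_integral_def by simp
  have diff: "set_integrable lborel {0..T} (\<lambda>s. (norm (g k s - h s))\<^sup>2)" for k
  proof (rule set_integrable_bound)
    show "set_integrable lborel {0..T} (\<lambda>s. 2 * (norm (g k s))\<^sup>2 + 2 * (norm (h s))\<^sup>2)"
      using g h by (intro set_integral_add set_integrable_mult_right) auto
    have "(\<lambda>s. indicator {0..T} s *\<^sub>R (norm (g k s - h s))\<^sup>2) =
        (\<lambda>s. indicator {0..T} s *\<^sub>R (norm (g k s - ?h s))\<^sup>2)"
      by (auto simp: indicator_def)
    then show "set_borel_measurable lborel {0..T} (\<lambda>s. (norm (g k s - h s))\<^sup>2)"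
      unfolding set_borel_measurable_def by simp
    have "(norm (g k s - h s))\<^sup>2 \<le> 2 * (norm (g k s))\<^sup>2 + 2 * (norm (h s))\<^sup>2" for s
    proof -
      have "(norm (g k s - h s))\<^sup>2 \<le> (norm (g k s) + norm (h s))\<^sup>2"
        by (intro power_mono norm_triangle_ineq4) auto
      also have "\<dots> \<le> 2 * (norm (g k s))\<^sup>2 + 2 * (norm (h s))\<^sup>2"
        using sum_squares_bound[of "norm (g k s)" "norm (h s)"] by (simp add: power2_sum)
      finally show ?thesis .
    qed
    then show "AE s in lborel. s \<in> {0..T} \<longrightarrow>
        norm ((norm (g k s - h s))\<^sup>2) \<le> norm (2 * (norm (g k s))\<^sup>2 + 2 * (norm (h s))\<^sup>2)"
      by simp
  qed
  have restrict: "set_integrable lborel {0..t} f" if "set_integrable lborel {0..T} f" for f :: "real \<Rightarrow> real"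
    using that t by (auto intro: set_integrable_subset)
  have sub: "(LINT s:{0..t}|lborel. f s) \<le> (LINT s:{0..T}|lborel. f s)"
    if "set_integrable lborel {0..T} f" "\<And>s. 0 \<le> f s" for f :: "real \<Rightarrow> real"
    using that restrict[OF that(1)] t unfolding set_lebesgue_integral_def set_integrable_def
    by (intro integral_mono) (auto simp: indicator_def)
  have bound: "norm ((LINT s:{0..t}|lborel. (norm (g k s))\<^sup>2) - (LINT s:{0..t}|lborel. (norm (h s))\<^sup>2))
      \<le> (1 + 1 / e) * D k + e * A" if e: "0 < e" for e k
  proof -
    have pw: "\<bar>(norm (g k s))\<^sup>2 - (norm (h s))\<^sup>2\<bar> \<le> (1 + 1 / e) * (norm (g k s - h s))\<^sup>2 + e * (norm (h s))\<^sup>2" for s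
    proof -
      let ?x = "norm (g k s)" and ?y = "norm (h s)" and ?d = "norm (g k s - h s)"
      have xy: "\<bar>?x - ?y\<bar> \<le> ?d" by (rule norm_triangle_ineq3)
      have "\<bar>?x\<^sup>2 - ?y\<^sup>2\<bar> = \<bar>?x - ?y\<bar> * (?x + ?y)"
        by (simp add: power2_eq_square square_diff_square_factored abs_mult)
      also have "\<dots> \<le> ?d * (?d + 2 * ?y)"
        using xy by (intro mult_mono) auto
      also have "\<dots> = ?d\<^sup>2 + 2 * (?d * ?y)"
        by (simp add: power2_eq_square algebra_simps)
      also have "2 * (?d * ?y) \<le> (1 / e) * ?d\<^sup>2 + e * ?y\<^sup>2"
      proof -
        have "0 \<le> (?d - e * ?y)\<^sup>2 / e" using e by simp
        also have "\<dots> = (1 / e) * ?d\<^sup>2 + e * ?y\<^sup>2 - 2 * (?d * ?y)"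
          using e by (simp add: power2_eq_square field_simps)
        finally show ?thesis by simp
      qed
      finally show ?thesis by (simp add: algebra_simps)
    qed
    have i: "set_integrable lborel {0..t} (\<lambda>s. (norm (g k s))\<^sup>2 - (norm (h s))\<^sup>2)"
      "set_integrable lborel {0..t} (\<lambda>s. (1 + 1 / e) * (norm (g k s - h s))\<^sup>2 + e * (norm (h s))\<^sup>2)"
      using g h diff by (auto intro!: restrict set_integral_diff set_integral_add set_integrable_mult_right)
    have "norm ((LINT s:{0..t}|lborel. (norm (g k s))\<^sup>2) - (LINT s:{0..t}|lborel. (norm (h s))\<^sup>2))
      = norm (LINT s:{0..t}|lborel. (norm (g k s))\<^sup>2 - (norm (h s))\<^sup>2)"
      using g h by (subst set_integral_diff) (auto intro: restrict)
    also have "\<dots> \<le> (LINT s:{0..t}|lborel. norm ((norm (g k s))\<^sup>2 - (norm (h s))\<^sup>2))"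
      by (rule set_integral_norm_bound[OF i(1)])
    also have "\<dots> \<le> (LINT s:{0..t}|lborel. (1 + 1 / e) * (norm (g k s - h s))\<^sup>2 + e * (norm (h s))\<^sup>2)"
      using pw i by (intro set_integral_mono set_integrable_norm) auto
    also have "\<dots> = (1 + 1 / e) * (LINT s:{0..t}|lborel. (norm (g k s - h s))\<^sup>2) + e * (LINT s:{0..t}|lborel. (norm (h s))\<^sup>2)"
      using diff h by (subst set_integral_add(2)) (auto intro!: restrict set_integrable_mult_right)
    also have "\<dots> \<le> (1 + 1 / e) * D k + e * A"
      unfolding D_def A_def using e diff h by (intro add_mono mult_left_mono sub) auto
    finally show ?thesis .
  qed
  show ?thesis
  proof (rule LIMSEQ_I)
    fix \<epsilon> :: real assume \<epsilon>: "0 < \<epsilon>"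
    \<comment> \<open>The summand 1 keeps the denominator positive when h vanishes almost
      everywhere.\<close>
    define e where "e = \<epsilon> / (2 * (A + 1))"
    have e: "0 < e" "e * A \<le> \<epsilon> / 2"
      using A_nonneg \<epsilon> by (auto simp: e_def field_simps)
    have "(\<lambda>k. (1 + 1 / e) * D k) \<longlonglongrightarrow> (1 + 1 / e) * 0"
      using lim unfolding D_def by (intro tendsto_intros)
    then have "eventually (\<lambda>k. (1 + 1 / e) * D k < \<epsilon> / 2) sequentially"
      using \<epsilon> by (intro order_tendstoD(2)) auto
    then have "eventually (\<lambda>k. norm ((LINT s:{0..t}|lborel. (norm (g k s))\<^sup>2) - (LINT s:{0..t}|lborel. (norm (h s))\<^sup>2)) < \<epsilon>) sequentially"
    proof eventually_elim
      case (elim k)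
      then show ?case using bound[OF e(1), of k] e(2) by linarith
    qed
    then show "\<exists>no. \<forall>k\<ge>no. norm ((LINT s:{0..t}|lborel. (norm (g k s))\<^sup>2) - (LINT s:{0..t}|lborel. (norm (h s))\<^sup>2)) < \<epsilon>"
      by (simp add: eventually_sequentially)
  qed
qed

section \<open>Passage to the limit for general integrands\<close>

context brownian_filtration
begin

text \<open>Fatou's lemma on the left and dominated convergence on the right carry
  \<open>simple_integral_second_moment\<close> to the limit. \<open>Q\<close> is built as a limit of
  \<open>simple_qv\<close> instead of being defined by the time integral: measurability in (t,
  \<omega>) is used later, and for H \<open>is_ito_integral\<close> gives measurability only along
  almost every path.\<close>

lemma ito_integral_second_moment:
  fixes H :: "real \<Rightarrow> 'w \<Rightarrow> real ^ 'd ^ 'n"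
  assumes ito: "is_ito_integral M T F W H I"
  obtains Q where "(\<lambda>(t, \<omega>). Q t \<omega>) \<in> borel_measurable (borel \<Otimes>\<^sub>M M)"
    and "AE \<omega> in M. \<forall>t\<in>{0..T}. Q t \<omega> = (LINT s:{0..t}|lborel. (norm (H s \<omega>))\<^sup>2)"
    and "\<And>t N. t \<in> {0..T} \<Longrightarrow> 0 \<le> N \<Longrightarrow>
      (\<integral>\<^sup>+\<omega>. ennreal (indicator {x. Q t x < N} \<omega> * (norm (I t \<omega>))\<^sup>2) \<partial>M)
        \<le> CARD('d) * (\<integral>\<^sup>+\<omega>. ennreal (min (Q t \<omega>) N) \<partial>M)"
proof -
  obtain p0 \<tau>0 \<xi>0 where sp0: "\<And>k. simple_integrand M T F (p0 k) (\<tau>0 k) (\<xi>0 k)"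
    and L2_prob: "tendsto_in_probability M
          (\<lambda>k \<omega>. LINT s:{0..T}|lborel. (norm (simple_process (p0 k) (\<tau>0 k) (\<xi>0 k) s \<omega> - H s \<omega>))\<^sup>2) (\<lambda>_. 0)"
    and I_prob0: "\<And>t. t \<in> {0..T} \<Longrightarrow> tendsto_in_probability M
          (\<lambda>k. simple_integral W (p0 k) (\<tau>0 k) (\<xi>0 k) t) (I t)"
    using ito unfolding is_ito_integral_def by (elim conjE exE) blast
  have H: "AE \<omega> in M. set_borel_measurable lborel {0..T} (\<lambda>s. H s \<omega>) \<and>
                 set_integrable lborel {0..T} (\<lambda>s. (norm (H s \<omega>))\<^sup>2)"
    using ito unfolding is_ito_integral_def by blast
  \<comment> \<open>Almost sure convergence in L2 over [0,T] yields convergence of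
    \<open>simple_qv\<close> at all times t outside one null set, so this subsequence is chosen
    once, independently of t.\<close>
  obtain r where r: "strict_mono r" and L2_AE: "AE \<omega> in M. (\<lambda>k. LINT s:{0..T}|lborel.
      (norm (simple_process (p0 (r k)) (\<tau>0 (r k)) (\<xi>0 (r k)) s \<omega> - H s \<omega>))\<^sup>2) \<longlonglongrightarrow> 0"
    using tendsto_in_probability_AE_subseq[OF L2_prob] by blast
  define p \<tau> \<xi> where "p k = p0 (r k)" and "\<tau> k = \<tau>0 (r k)" and "\<xi> k = \<xi>0 (r k)" for k
  have sp: "simple_integrand M T F (p k) (\<tau> k) (\<xi> k)" for k
    using sp0 by (simp add: p_def \<tau>_def \<xi>_def)
  have I_prob: "tendsto_in_probability M (\<lambda>k. simple_integral W (p k) (\<tau> k) (\<xi> k) t) (I t)"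
    if "t \<in> {0..T}" for t
    using tendsto_in_probability_subseq[OF I_prob0[OF that] r] by (simp add: p_def \<tau>_def \<xi>_def)
  define q where "q k t \<omega> = simple_qv (p k) (\<tau> k) (\<xi> k) t \<omega>" for k t \<omega>
  define Q where "Q t \<omega> = lim (\<lambda>k. q k t \<omega>)" for t \<omega>
  have \<xi>_M: "\<xi> k i \<in> borel_measurable M" if "i < p k" for k i
    using sp[of k] simple_integrand_range[OF sp, of i k] that
    by (intro measurable_F_M[of "\<xi> k i" "\<tau> k i"]) (auto simp: simple_integrand_def)
  have q_meas[measurable]: "(\<lambda>(t, \<omega>). q k t \<omega>) \<in> borel_measurable (borel \<Otimes>\<^sub>M M)" for k
  proof -
    have "(\<lambda>x. (min (fst x) (\<tau> k (Suc i)) - min (fst x) (\<tau> k i)) * (norm (\<xi> k i (snd x)))\<^sup>2)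
        \<in> borel_measurable (borel \<Otimes>\<^sub>M M)" if "i < p k" for i
    proof -
      note [measurable] = \<xi>_M[OF that]
      show ?thesis by measurable
    qed
    then show ?thesis
      unfolding q_def simple_qv_def case_prod_beta by (auto intro: borel_measurable_sum)
  qed
  have Q_meas[measurable]: "(\<lambda>(t, \<omega>). Q t \<omega>) \<in> borel_measurable (borel \<Otimes>\<^sub>M M)"
    unfolding Q_def case_prod_beta using q_meas by (intro borel_measurable_lim_metric) (simp add: case_prod_beta)
  have q_lim: "AE \<omega> in M. \<forall>t\<in>{0..T}. (\<lambda>k. q k t \<omega>) \<longlonglongrightarrow> (LINT s:{0..t}|lborel. (norm (H s \<omega>))\<^sup>2)"
    using H L2_AE
  proof eventually_elim
    case (elim \<omega>)
    show ?case
    proof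
      fix t assume t: "t \<in> {0..T}"
      have "(\<lambda>k. LINT s:{0..t}|lborel. (norm (simple_process (p k) (\<tau> k) (\<xi> k) s \<omega>))\<^sup>2)
          \<longlonglongrightarrow> (LINT s:{0..t}|lborel. (norm (H s \<omega>))\<^sup>2)"
        using elim t square_integral_simple_process(1)[OF sp, of T]
        by (intro square_integral_tendsto[where T = T]) (auto simp: p_def \<tau>_def \<xi>_def)
      then show "(\<lambda>k. q k t \<omega>) \<longlonglongrightarrow> (LINT s:{0..t}|lborel. (norm (H s \<omega>))\<^sup>2)"
        using t by (simp add: q_def square_integral_simple_process(2)[OF sp])
    qed
  qed
  have q_Q: "AE \<omega> in M. \<forall>t\<in>{0..T}. (\<lambda>k. q k t \<omega>) \<longlonglongrightarrow> Q t \<omega>"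
    using q_lim by eventually_elim (auto simp: Q_def limI)
  have Q_eq: "AE \<omega> in M. \<forall>t\<in>{0..T}. Q t \<omega> = (LINT s:{0..t}|lborel. (norm (H s \<omega>))\<^sup>2)"
    using q_lim by eventually_elim (auto simp: Q_def limI)
  have "(\<integral>\<^sup>+\<omega>. ennreal (indicator {x. Q t x < N} \<omega> * (norm (I t \<omega>))\<^sup>2) \<partial>M)
        \<le> CARD('d) * (\<integral>\<^sup>+\<omega>. ennreal (min (Q t \<omega>) N) \<partial>M)" if t: "t \<in> {0..T}" and N: "0 \<le> N" for t N
  proof -
    \<comment> \<open>This further subsequence depends on t, which is harmless: the estimate
      concerns a fixed time.\<close>
    obtain r' where r': "strict_mono r'"
      and I_AE: "AE \<omega> in M. (\<lambda>k. simple_integral W (p (r' k)) (\<tau> (r' k)) (\<xi> (r' k)) t \<omega>) \<longlonglongrightarrow> I t \<omega>"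
      using tendsto_in_probability_AE_subseq[OF I_prob[OF t]] by blast
    have [measurable]: "q k t \<in> borel_measurable M" "Q t \<in> borel_measurable M" for k
      using measurable_compose[OF measurable_Pair1' q_meas, of t k] measurable_compose[OF measurable_Pair1' Q_meas, of t]
      by simp_all
    have [measurable]: "simple_integral W (p k) (\<tau> k) (\<xi> k) t \<in> borel_measurable M" for k
      using I_prob[OF t] by (simp add: tendsto_in_probability_def)
    define u where "u k \<omega> = ennreal (indicator {x. q (r' k) t x \<le> N} \<omega> *
      (norm (simple_integral W (p (r' k)) (\<tau> (r' k)) (\<xi> (r' k)) t \<omega>))\<^sup>2)" for k \<omega>
    define m where "m k \<omega> = ennreal (min (q (r' k) t \<omega>) N)" for k \<omega>
    have q_Q': "AE \<omega> in M. (\<lambda>k. q (r' k) t \<omega>) \<longlonglongrightarrow> Q t \<omega>"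
      using q_Q
    proof eventually_elim
      case (elim \<omega>)
      then have "(\<lambda>k. q k t \<omega>) \<longlonglongrightarrow> Q t \<omega>" using t by blast
      from LIMSEQ_subseq_LIMSEQ[OF this r'] show ?case by (simp add: comp_def)
    qed
    have u_meas: "u k \<in> borel_measurable M" for k
      unfolding u_def indicator_def by measurable
    have [measurable]: "m k \<in> borel_measurable M" for k
      unfolding m_def by measurable
    have "(\<integral>\<^sup>+\<omega>. ennreal (indicator {x. Q t x < N} \<omega> * (norm (I t \<omega>))\<^sup>2) \<partial>M)
        \<le> (\<integral>\<^sup>+\<omega>. liminf (\<lambda>k. u k \<omega>) \<partial>M)"
    proof (rule nn_integral_mono_AE)
      show "AE \<omega> in M. ennreal (indicator {x. Q t x < N} \<omega> * (norm (I t \<omega>))\<^sup>2) \<le> liminf (\<lambda>k. u k \<omega>)"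
        using q_Q' I_AE
      proof eventually_elim
        case (elim \<omega>)
        show ?case
        proof (cases "Q t \<omega> < N")
          case True
          \<comment> \<open>Q t < N is an open condition and passes to the approximations; at Q t =
            N they could lie above N. Hence the strict inequality in the truncation.\<close>
          have "eventually (\<lambda>k. q (r' k) t \<omega> < N) sequentially"
            using elim(1) True by (rule order_tendstoD)
          then have "eventually (\<lambda>k. ennreal ((norm (simple_integral W (p (r' k)) (\<tau> (r' k)) (\<xi> (r' k)) t \<omega>))\<^sup>2) = u k \<omega>) sequentially"
            by eventually_elim (simp add: u_def)
          moreover have "(\<lambda>k. ennreal ((norm (simple_integral W (p (r' k)) (\<tau> (r' k)) (\<xi> (r' k)) t \<omega>))\<^sup>2)) \<longlonglongrightarrow> ennreal ((norm (I t \<omega>))\<^sup>2)"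
            using elim(2) by (intro tendsto_ennrealI tendsto_power tendsto_norm)
          ultimately have "(\<lambda>k. u k \<omega>) \<longlonglongrightarrow> ennreal ((norm (I t \<omega>))\<^sup>2)"
            by (rule Lim_transform_eventually[rotated])
          then show ?thesis
            using True by (simp add: lim_imp_Liminf)
        qed simp
      qed
    qed
    also have "\<dots> \<le> liminf (\<lambda>k. \<integral>\<^sup>+\<omega>. u k \<omega> \<partial>M)"
      using u_meas by (rule nn_integral_liminf)
    also have "\<dots> \<le> liminf (\<lambda>k. CARD('d) * (\<integral>\<^sup>+\<omega>. m k \<omega> \<partial>M))"
      using simple_integral_second_moment[OF sp t N]
      by (intro Liminf_mono always_eventually) (auto simp: u_def m_def q_def)
    also have "\<dots> = CARD('d) * (\<integral>\<^sup>+\<omega>. ennreal (min (Q t \<omega>) N) \<partial>M)"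
    proof (intro lim_imp_Liminf ennreal_tendsto_cmult)
      show "(\<lambda>k. \<integral>\<^sup>+\<omega>. m k \<omega> \<partial>M) \<longlonglongrightarrow> (\<integral>\<^sup>+\<omega>. ennreal (min (Q t \<omega>) N) \<partial>M)"
      proof (rule nn_integral_dominated_convergence[where w = "\<lambda>_. ennreal N"])
        show "AE \<omega> in M. (\<lambda>k. m k \<omega>) \<longlonglongrightarrow> ennreal (min (Q t \<omega>) N)"
          using q_Q' unfolding m_def by eventually_elim (intro tendsto_ennrealI tendsto_min tendsto_const)
      qed (auto simp: m_def emeasure_space_1 intro!: ennreal_leI)
    qed (auto simp: of_nat_less_top)
    finally show ?thesis .
  qed
  then show thesis
    using that[OF Q_meas Q_eq] by blast
qed

end

section \<open>Second moments of controlled diffusions\<close>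

text \<open>Supplies the joint measurability that Tonelli's theorem requires from processes
  measurable at each fixed time. The path is sampled at the last point of a grid of mesh 1/(n+1) not
  after t, so for fixed n only countably many sampling times occur; continuity brings the samples to
  the value at t. Continuity holds almost surely, hence a version.\<close>

lemma continuous_paths_measurable_version:
  fixes Y :: "real \<Rightarrow> 'w \<Rightarrow> 'b::{banach, second_countable_topology}"
  assumes T: "0 \<le> T" and meas: "\<And>t. t \<in> {0..T} \<Longrightarrow> Y t \<in> borel_measurable M"
    and cont: "continuous_paths M T Y"
  obtains Z where "(\<lambda>(t, \<omega>). Z t \<omega>) \<in> borel_measurable (borel \<Otimes>\<^sub>M M)"
    and "AE \<omega> in M. \<forall>t\<in>{0..T}. Z t \<omega> = Y t \<omega>"
proof -
  \<comment> \<open>Clamps grid points into [0,T], the times at which \<open>Y\<close> is assumed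
    measurable, so that \<open>Z\<close> is measurable over all real t.\<close>
  define c where "c s = max 0 (min T s)" for s
  have c_in: "c s \<in> {0..T}" for s using T by (auto simp: c_def)
  define a where "a n t = \<lfloor>t * real (Suc n)\<rfloor>" for n t
  define Z where "Z t \<omega> = lim (\<lambda>n. Y (c (a n t / real (Suc n))) \<omega>)" for t \<omega>
  have "(\<lambda>x. Y (c (a n (fst x) / real (Suc n))) (snd x)) \<in> borel_measurable (borel \<Otimes>\<^sub>M M)" for n
  proof (rule measurable_compose_countable[where g = "\<lambda>x. a n (fst x)"])
    fix i :: int
    have "Y (c (i / real (Suc n))) \<in> borel_measurable M" by (rule meas[OF c_in])
    then show "(\<lambda>x. Y (c (i / real (Suc n))) (snd x)) \<in> borel_measurable (borel \<Otimes>\<^sub>M M)"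
      by measurable
    show "(\<lambda>x. a n (fst x)) \<in> borel \<Otimes>\<^sub>M M \<rightarrow>\<^sub>M count_space UNIV"
      unfolding a_def by measurable
  qed
  then have "(\<lambda>x. Z (fst x) (snd x)) \<in> borel_measurable (borel \<Otimes>\<^sub>M M)"
    unfolding Z_def by (rule borel_measurable_lim_metric)
  moreover have "AE \<omega> in M. \<forall>t\<in>{0..T}. Z t \<omega> = Y t \<omega>"
    using cont unfolding continuous_paths_def
  proof eventually_elim
    case (elim \<omega>)
    show ?case
    proof
      fix t assume t: "t \<in> {0..T}"
      have "(\<lambda>n. a n t / real (Suc n)) \<longlonglongrightarrow> t"
      proof (rule tendsto_sandwich)
        have "(\<lambda>n. t - 1 / real (Suc n)) \<longlonglongrightarrow> t - 0"
          using LIMSEQ_inverse_real_of_nat by (intro tendsto_diff tendsto_const) (simp add: divide_inverse)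
        then show "(\<lambda>n. t - 1 / real (Suc n)) \<longlonglongrightarrow> t" by simp
        show "(\<lambda>_. t) \<longlonglongrightarrow> t" by simp
        show "eventually (\<lambda>n. t - 1 / real (Suc n) \<le> a n t / real (Suc n)) sequentially"
        proof (intro always_eventually allI)
          fix n
          have "t * real (Suc n) - 1 \<le> a n t" unfolding a_def by linarith
          then have "(t * real (Suc n) - 1) / real (Suc n) \<le> a n t / real (Suc n)"
            by (intro divide_right_mono) auto
          then show "t - 1 / real (Suc n) \<le> a n t / real (Suc n)"
            by (simp add: diff_divide_distrib del: of_nat_Suc)
        qed
        show "eventually (\<lambda>n. a n t / real (Suc n) \<le> t) sequentially"
        proof (intro always_eventually allI)
          fix n
          have "a n t \<le> t * real (Suc n)" unfolding a_def by linarith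
          then show "a n t / real (Suc n) \<le> t"
            by (simp add: divide_le_eq del: of_nat_Suc)
        qed
      qed
      then have "(\<lambda>n. c (a n t / real (Suc n))) \<longlonglongrightarrow> c t"
        unfolding c_def by (intro tendsto_max tendsto_min tendsto_const)
      moreover have "c t = t" using t by (auto simp: c_def)
      ultimately have "(\<lambda>n. Y (c (a n t / real (Suc n))) \<omega>) \<longlonglongrightarrow> Y t \<omega>"
        using elim t c_in unfolding continuous_on_sequentially comp_def by auto
      then show "Z t \<omega> = Y t \<omega>"
        by (simp add: Z_def limI)
    qed
  qed
  ultimately show thesis
    using that[of Z] by (simp add: case_prod_beta)
qed

section \<open>Gronwall's inequality for nonnegative integrals\<close>

text \<open>The bound concerns the integral of u; values of u are recovered by inserting it into the
  hypothesis once more. Half of the weighted integral \<open>\<Phi>\<close> is absorbed into the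
  left-hand side, which gives the factor 2; the exponential is the price of removing the weight on
  [0,T].\<close>

lemma gronwall_nn_integral:
  fixes u b :: "real \<Rightarrow> ennreal" and c T :: real
  assumes [measurable]: "u \<in> borel_measurable borel" "b \<in> borel_measurable borel"
    and c: "0 < c"
    and u: "\<And>t. t \<in> {0..T} \<Longrightarrow> u t \<le> b t + c * (\<integral>\<^sup>+s\<in>{0..t}. u s \<partial>lborel)"
    and fin: "(\<integral>\<^sup>+s\<in>{0..T}. u s \<partial>lborel) < \<infinity>" and t: "t \<in> {0..T}"
  shows "(\<integral>\<^sup>+s\<in>{0..t}. u s \<partial>lborel) \<le> ennreal (2 * exp (2 * c * T)) * (\<integral>\<^sup>+s\<in>{0..t}. b s \<partial>lborel)"
proof -
  \<comment> \<open>Under the weight \<open>e\<close>, the Volterra operator on the right-hand side has norm at most \<open>1/2\<close>.\<close>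
  define e where "e s = ennreal (exp (- (2 * c * s)))" for s
  have [measurable]: "e \<in> borel_measurable borel" unfolding e_def by measurable
  have e1: "e s \<le> 1" if "0 \<le> s" for s
    using that c by (simp add: e_def)
  define \<Phi> where "\<Phi> = (\<integral>\<^sup>+s\<in>{0..t}. (e s * u s) \<partial>lborel)"
  define B where "B = (\<integral>\<^sup>+s\<in>{0..t}. b s \<partial>lborel)"
  have "\<Phi> \<le> (\<integral>\<^sup>+s\<in>{0..T}. u s \<partial>lborel)"
    unfolding \<Phi>_def using t e1
    by (intro nn_integral_mono) (auto simp: indicator_def intro: mult_right_mono[of "e _" 1, simplified])
  then have \<Phi>_fin: "\<Phi> \<noteq> \<top>" using fin by (auto simp: top_unique)
  \<comment> \<open>The rate 2c of the weight makes c times this tail equal to half the weight at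
    r.\<close>
  have tail: "(\<integral>\<^sup>+s. e s * indicator {r..} s \<partial>lborel) = ennreal (exp (- (2 * c * r)) / (2 * c))" for r
  proof -
    have "(\<integral>\<^sup>+s. ennreal (exp (- (2 * c * s))) * indicator {r..} s \<partial>lborel)
        = 0 - (- (exp (- (2 * c * r)) / (2 * c)))"
    proof (rule nn_integral_FTC_atLeast[where F = "\<lambda>s. - (exp (- (2 * c * s)) / (2 * c))"])
      show "((\<lambda>s. - (exp (- (2 * c * s)) / (2 * c))) has_real_derivative exp (- (2 * c * x))) (at x)" for x
        using c by (auto intro!: derivative_eq_intros)
      have "((\<lambda>s. exp (- (2 * c * s))) \<longlongrightarrow> 0) at_top"
      proof (rule filterlim_compose[OF exp_at_bot])
        show "filterlim (\<lambda>s. - (2 * c * s)) at_bot at_top"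
          unfolding filterlim_uminus_at_bot
          using c by (simp add: filterlim_tendsto_pos_mult_at_top[OF tendsto_const _ filterlim_ident])
      qed
      then have "((\<lambda>s. - (exp (- (2 * c * s)) / (2 * c))) \<longlongrightarrow> - (0 / (2 * c))) at_top"
        using c by (intro tendsto_intros) auto
      then show "((\<lambda>s. - (exp (- (2 * c * s)) / (2 * c))) \<longlongrightarrow> 0) at_top" by simp
    qed auto
    then show ?thesis by (simp add: e_def)
  qed
  \<comment> \<open>The range r \<le> s \<le> t of the double integral is enlarged to all s \<ge> r,
    so that after exchanging the integrals the inner one is the explicit tail.\<close>
  have "\<Phi> \<le> (\<integral>\<^sup>+s. b s * indicator {0..t} s + (\<integral>\<^sup>+r. c * e s * u r * indicator {0..t} r * indicator {r..} s \<partial>lborel) \<partial>lborel)"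
    unfolding \<Phi>_def
  proof (rule nn_integral_mono)
    fix s
    show "e s * u s * indicator {0..t} s \<le>
        b s * indicator {0..t} s + (\<integral>\<^sup>+r. c * e s * u r * indicator {0..t} r * indicator {r..} s \<partial>lborel)"
    proof (cases "s \<in> {0..t}")
      case True
      have "e s * u s \<le> e s * b s + e s * (c * (\<integral>\<^sup>+r\<in>{0..s}. u r \<partial>lborel))"
        using u[of s] True t unfolding distrib_left[symmetric] by (intro mult_left_mono) auto
      also have "e s * b s \<le> b s"
        using mult_right_mono[OF e1, of s "b s"] True by simp
      also have "e s * (c * (\<integral>\<^sup>+r\<in>{0..s}. u r \<partial>lborel)) = (\<integral>\<^sup>+r. c * e s * (u r * indicator {0..s} r) \<partial>lborel)"
        by (simp add: nn_integral_cmult ac_simps)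
      also have "\<dots> \<le> (\<integral>\<^sup>+r. c * e s * u r * indicator {0..t} r * indicator {r..} s \<partial>lborel)"
        using True by (intro nn_integral_mono) (auto simp: indicator_def)
      finally show ?thesis using True by (simp add: add_mono)
    qed simp
  qed
  also have "\<dots> = B + (\<integral>\<^sup>+s. (\<integral>\<^sup>+r. c * e s * u r * indicator {0..t} r * indicator {r..} s \<partial>lborel) \<partial>lborel)"
    unfolding B_def by (subst nn_integral_add) (auto simp: indicator_def)
  also have "(\<integral>\<^sup>+s. (\<integral>\<^sup>+r. c * e s * u r * indicator {0..t} r * indicator {r..} s \<partial>lborel) \<partial>lborel)
      = (\<integral>\<^sup>+r. (\<integral>\<^sup>+s. c * e s * u r * indicator {0..t} r * indicator {r..} s \<partial>lborel) \<partial>lborel)"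
    unfolding indicator_def by (intro lborel_pair.Fubini') auto
  also have "\<dots> = (\<integral>\<^sup>+r. ennreal (1 / 2) * (e r * u r * indicator {0..t} r) \<partial>lborel)"
  proof (rule nn_integral_cong)
    fix r
    have "(\<integral>\<^sup>+s. c * e s * u r * indicator {0..t} r * indicator {r..} s \<partial>lborel)
        = (\<integral>\<^sup>+s. (c * u r * indicator {0..t} r) * (e s * indicator {r..} s) \<partial>lborel)"
      by (simp add: ac_simps)
    also have "\<dots> = (c * u r * indicator {0..t} r) * ennreal (exp (- (2 * c * r)) / (2 * c))"
      by (subst nn_integral_cmult) (auto simp: tail)
    also have "\<dots> = ennreal (c * (exp (- (2 * c * r)) / (2 * c))) * (u r * indicator {0..t} r)"
      unfolding ennreal_mult'[OF less_imp_le[OF c]] by (simp only: ac_simps)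
    also have "c * (exp (- (2 * c * r)) / (2 * c)) = (1 / 2) * exp (- (2 * c * r))"
      using c by simp
    also have "ennreal \<dots> = ennreal (1 / 2) * e r"
      unfolding e_def by (rule ennreal_mult) auto
    finally show "(\<integral>\<^sup>+s. c * e s * u r * indicator {0..t} r * indicator {r..} s \<partial>lborel)
        = ennreal (1 / 2) * (e r * u r * indicator {0..t} r)"
      by (simp add: ac_simps)
  qed
  also have "\<dots> = ennreal (1 / 2) * \<Phi>"
    unfolding \<Phi>_def by (rule nn_integral_cmult) measurable
  finally have "\<Phi> \<le> B + ennreal (1 / 2) * \<Phi>" .
  moreover have "\<Phi> = ennreal (1 / 2) * \<Phi> + ennreal (1 / 2) * \<Phi>"
  proof -
    have "ennreal (1 / 2) + ennreal (1 / 2) = 1"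
      by (subst ennreal_plus[symmetric]) auto
    then show ?thesis by (simp only: distrib_right[symmetric] mult_1)
  qed
  ultimately have "ennreal (1 / 2) * \<Phi> + ennreal (1 / 2) * \<Phi> \<le> ennreal (1 / 2) * \<Phi> + B"
    by (simp add: add.commute)
  \<comment> \<open>Cancelling half of \<open>\<Phi>\<close> is legitimate because it is finite;
    this is where the hypothesis \<open>fin\<close> enters.\<close>
  then have half: "ennreal (1 / 2) * \<Phi> \<le> B"
    using \<Phi>_fin by (simp add: ennreal_add_left_cancel_le ennreal_mult_eq_top_iff)
  have "(\<integral>\<^sup>+s\<in>{0..t}. u s \<partial>lborel) \<le> (\<integral>\<^sup>+s. ennreal (exp (2 * c * T)) * (e s * u s * indicator {0..t} s) \<partial>lborel)"
  proof (rule nn_integral_mono)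
    fix s
    show "u s * indicator {0..t} s \<le> ennreal (exp (2 * c * T)) * (e s * u s * indicator {0..t} s)"
    proof (cases "s \<in> {0..t}")
      case True
      have "1 \<le> exp (2 * c * T) * exp (- (2 * c * s))"
        using True t c by (simp flip: exp_add)
      then have "1 \<le> ennreal (exp (2 * c * T)) * e s"
        unfolding e_def by (simp flip: ennreal_mult)
      from mult_right_mono[OF this, of "u s"] show ?thesis
        using True by (simp add: ac_simps)
    qed simp
  qed
  also have "\<dots> = ennreal (exp (2 * c * T)) * \<Phi>"
    unfolding \<Phi>_def by (rule nn_integral_cmult) measurable
  also have "\<dots> = ennreal (2 * exp (2 * c * T)) * (ennreal (1 / 2) * \<Phi>)"
  proof -
    have "ennreal (2 * exp (2 * c * T) * (1 / 2)) = ennreal (2 * exp (2 * c * T)) * ennreal (1 / 2)"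
      by (rule ennreal_mult) auto
    moreover have "2 * exp (2 * c * T) * (1 / 2) = exp (2 * c * T)" by simp
    ultimately have "ennreal (exp (2 * c * T)) = ennreal (2 * exp (2 * c * T)) * ennreal (1 / 2)"
      by (simp only:)
    then show ?thesis by (simp add: ac_simps)
  qed
  also have "\<dots> \<le> ennreal (2 * exp (2 * c * T)) * B"
    using half by (intro mult_left_mono) auto
  finally show ?thesis unfolding B_def .
qed

section \<open>Pathwise estimates\<close>

lemma nn_integral_set_eq_integral:
  fixes f :: "'a \<Rightarrow> real"
  assumes "set_integrable M A f" "\<And>x. 0 \<le> f x"
  shows "(\<integral>\<^sup>+x\<in>A. ennreal (f x) \<partial>M) = ennreal (LINT x:A|M. f x)"
proof -
  have "(\<integral>\<^sup>+x. ennreal (indicator A x *\<^sub>R f x) \<partial>M) = ennreal (LINT x:A|M. f x)"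
    using assms unfolding set_integrable_def set_lebesgue_integral_def
    by (intro nn_integral_eq_integral) auto
  then show ?thesis
    by (simp add: ennreal_mult'' ennreal_indicator mult.commute)
qed

lemma continuous_on_set_integral:
  fixes f :: "real \<Rightarrow> 'b::euclidean_space"
  assumes "set_integrable lborel {0..T} f"
  shows "continuous_on {0..T} (\<lambda>t. LINT s:{0..t}|lborel. f s)"
proof -
  have "integral {0..t} f = (LINT s:{0..t}|lborel. f s)" if "t \<in> {0..T}" for t
    using that by (intro set_borel_integral_eq_integral(2)[symmetric] set_integrable_subset[OF assms]) auto
  moreover have "continuous_on {0..T} (\<lambda>t. integral {0..t} f)"
    by (intro indefinite_integral_continuous_1 set_borel_integral_eq_integral assms)
  ultimately show ?thesis
    by (rule continuous_on_eq[rotated])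
qed

lemma set_integral_lborel_singleton:
  fixes f :: "real \<Rightarrow> 'b::{banach, second_countable_topology}"
  shows "(LINT s:{a}|lborel. f s) = 0"
  unfolding set_lebesgue_integral_def
  by (rule integral_eq_zero_AE) (use AE_lborel_singleton[of a] in \<open>eventually_elim, simp\<close>)

text \<open>Cauchy-Schwarz in time and (a+b+c)^2 \<le> 3 (a^2+b^2+c^2) turn a linear bound into
  Gronwall form for the square. Here x stands for |X| and y for |I t| along one path; integrability
  comes from continuity, not from moments.\<close>

lemma square_pathwise_bound:
  fixes x :: "real \<Rightarrow> real"
  assumes x: "continuous_on {0..T} x" "\<And>s. 0 \<le> x s" and t: "t \<in> {0..T}" and k: "0 \<le> k" and y: "0 \<le> y"
    and le: "x t \<le> k * (1 + (LINT s:{0..t}|lborel. 1 + x s)) + y"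
  shows "ennreal ((x t)\<^sup>2) \<le> ennreal (3 * k\<^sup>2 * (1 + T)\<^sup>2 + 3 * y\<^sup>2)
    + ennreal (3 * k\<^sup>2 * T) * (\<integral>\<^sup>+s\<in>{0..t}. ennreal ((x s)\<^sup>2) \<partial>lborel)"
proof -
  have cont: "continuous_on {0..t} x"
    using x(1) t by (auto intro: continuous_on_subset)
  have int[simp]: "set_integrable lborel {0..t} x" "set_integrable lborel {0..t} (\<lambda>s. (x s)\<^sup>2)"
    "\<And>c. set_integrable lborel {0..t} (\<lambda>s. c :: real)" "\<And>c. set_integrable lborel {0..t} (\<lambda>s. c * x s)"
    using cont by (auto intro!: borel_integrable_atLeastAtMost' continuous_intros)
  have const: "(LINT s:{0..t}|lborel. c) = t * c" for c :: real
    using t by (simp add: set_lebesgue_integral_def)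
  define J where "J = (LINT s:{0..t}|lborel. x s)"
  define S where "S = (LINT s:{0..t}|lborel. (x s)\<^sup>2)"
  have S_nonneg: "0 \<le> S" and J_nonneg: "0 \<le> J"
    unfolding S_def J_def set_lebesgue_integral_def using x(2) by (auto intro!: integral_nonneg_AE)
  have JS: "J\<^sup>2 \<le> t * S"
  proof (cases "t = 0")
    case True
    then have "J = 0"
      by (simp add: J_def set_integral_lborel_singleton)
    then show ?thesis using True by simp
  next
    case False
    then have tp: "0 < t" using t by simp
    \<comment> \<open>\<open>m\<close> is the time average of x; integrating (x s - m)^2 \<ge> 0
      gives Cauchy-Schwarz against the constant 1.\<close>
    define m where "m = J / t"
    have "0 \<le> (LINT s:{0..t}|lborel. (x s)\<^sup>2 - (2 * m) * x s + m\<^sup>2)"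
    proof -
      have "(x s)\<^sup>2 - (2 * m) * x s + m\<^sup>2 = (x s - m)\<^sup>2" for s
        by (simp add: power2_diff)
      then show ?thesis unfolding set_lebesgue_integral_def by (auto intro!: integral_nonneg_AE)
    qed
    also have "\<dots> = S - (2 * m) * J + t * m\<^sup>2"
      by (simp add: set_integral_add set_integral_diff const S_def J_def)
    also have "\<dots> = S - J\<^sup>2 / t"
      using tp by (simp add: m_def power2_eq_square field_simps)
    finally show ?thesis using tp by (simp add: field_simps)
  qed
  have "(LINT s:{0..t}|lborel. 1 + x s) = t + J"
    by (simp add: set_integral_add const J_def)
  with le have "x t \<le> k * (1 + t) + k * J + y"
    by (simp add: algebra_simps)
  then have "(x t)\<^sup>2 \<le> (k * (1 + t) + k * J + y)\<^sup>2"
    using x(2) by (intro power_mono) auto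
  also have "\<dots> \<le> 3 * (k * (1 + t))\<^sup>2 + 3 * (k * J)\<^sup>2 + 3 * y\<^sup>2"
  proof -
    \<comment> \<open>Adding these three squares to the square of the sum gives exactly three times
      the sum of squares.\<close>
    have "0 \<le> (a - b)\<^sup>2 + (b - c)\<^sup>2 + (c - a)\<^sup>2" for a b c :: real by simp
    from this[of "k * (1 + t)" "k * J" y] show ?thesis
      by (simp add: power2_eq_square algebra_simps)
  qed
  also have "\<dots> \<le> (3 * k\<^sup>2 * (1 + T)\<^sup>2 + 3 * y\<^sup>2) + (3 * k\<^sup>2 * T) * S"
  proof -
    have "(1 + t)\<^sup>2 \<le> (1 + T)\<^sup>2" using t by (intro power_mono) auto
    then have "k\<^sup>2 * (1 + t)\<^sup>2 \<le> k\<^sup>2 * (1 + T)\<^sup>2" by (intro mult_left_mono) auto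
    moreover have "t * S \<le> T * S" using t S_nonneg by (intro mult_right_mono) auto
    with JS have "k\<^sup>2 * J\<^sup>2 \<le> k\<^sup>2 * (T * S)" by (intro mult_left_mono) auto
    ultimately show ?thesis by (simp add: power_mult_distrib)
  qed
  finally have "ennreal ((x t)\<^sup>2) \<le> ennreal ((3 * k\<^sup>2 * (1 + T)\<^sup>2 + 3 * y\<^sup>2) + (3 * k\<^sup>2 * T) * S)"
    by (rule ennreal_leI)
  also have "\<dots> = ennreal (3 * k\<^sup>2 * (1 + T)\<^sup>2 + 3 * y\<^sup>2) + ennreal (3 * k\<^sup>2 * T) * ennreal S"
    using t S_nonneg by (simp add: ennreal_plus ennreal_mult)
  also have "ennreal S = (\<integral>\<^sup>+s\<in>{0..t}. ennreal ((x s)\<^sup>2) \<partial>lborel)"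
    unfolding S_def by (rule nn_integral_set_eq_integral[symmetric]) auto
  finally show ?thesis .
qed

text \<open>The substitute for stopping Q at level N. As long as Q is below N the truncation in the
  integrand is inactive. If Q t is at least N, continuity makes Q attain every level n with 0 \<le>
  n < N at some time r \<le> t, and the integrand up to r already contributes n; no hitting time is
  formed.\<close>

lemma min_integral_le_truncated:
  fixes h v Q :: "real \<Rightarrow> real"
  assumes h: "set_integrable lborel {0..T} h" "\<And>s. 0 \<le> h s"
    and Q: "\<And>t. t \<in> {0..T} \<Longrightarrow> Q t = (LINT s:{0..t}|lborel. h s)"
    and v: "\<And>s. s \<in> {0..T} \<Longrightarrow> h s \<le> v s" and t: "t \<in> {0..T}" and N: "0 < N"
  shows "ennreal (min (Q t) N) \<le> (\<integral>\<^sup>+s\<in>{0..t}. ennreal (if Q s < N then v s else 0) \<partial>lborel)"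
proof -
  have int: "set_integrable lborel {0..s} h" if "s \<in> {0..T}" for s
    using h(1) that by (auto intro: set_integrable_subset)
  have Q_mono: "Q s \<le> Q r" if "0 \<le> s" "s \<le> r" "r \<le> T" for s r
  proof -
    have "(LINT u:{0..s}|lborel. h u) \<le> (LINT u:{0..r}|lborel. h u)"
      using int[of s] int[of r] that h(2) unfolding set_lebesgue_integral_def set_integrable_def
      by (intro integral_mono) (auto simp: indicator_def)
    then show ?thesis using that by (simp add: Q)
  qed
  have below: "ennreal (Q r) \<le> (\<integral>\<^sup>+s\<in>{0..t}. ennreal (if Q s < N then v s else 0) \<partial>lborel)"
    if r: "r \<in> {0..t}" "Q r < N" for r
  proof -
    have "ennreal (Q r) = (\<integral>\<^sup>+s\<in>{0..r}. ennreal (h s) \<partial>lborel)"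
      using r t by (simp add: Q nn_integral_set_eq_integral[OF int h(2)])
    also have "\<dots> \<le> (\<integral>\<^sup>+s\<in>{0..t}. ennreal (if Q s < N then v s else 0) \<partial>lborel)"
    proof (rule nn_integral_mono)
      fix s
      have "Q s < N" "h s \<le> v s" if "0 \<le> s" "s \<le> r"
        using Q_mono[of s r] v[of s] that r t by auto
      then show "ennreal (h s) * indicator {0..r} s \<le> ennreal (if Q s < N then v s else 0) * indicator {0..t} s"
        using r by (auto simp: indicator_def intro: ennreal_leI)
    qed
    finally show ?thesis .
  qed
  show ?thesis
  proof (cases "Q t < N")
    case True
    then show ?thesis using below[of t] t by (simp add: min_def)
  next
    case False
    have cont: "continuous_on {0..t} Q"
    proof (rule continuous_on_eq)
      show "continuous_on {0..t} (\<lambda>t. LINT s:{0..t}|lborel. h s)"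
        by (rule continuous_on_set_integral[OF int[OF t]])
    qed (use t Q in auto)
    have Q0: "Q 0 \<le> 0"
      using Q[of 0] t by (simp add: set_integral_lborel_singleton)
    show ?thesis
    proof (rule dense_le)
      \<comment> \<open>The truncation is strict, so level N is approximated from below instead of
        being attained.\<close>
      fix z assume "z < ennreal (min (Q t) N)"
      then have "z < ennreal N" using False by simp
      then obtain n where n: "z = ennreal n" "0 \<le> n" "n < N"
        by (cases z) (auto simp: ennreal_less_iff)
      have "\<exists>r\<ge>0. r \<le> t \<and> Q r = n"
        using Q0 n False t cont by (intro IVT') auto
      then show "z \<le> (\<integral>\<^sup>+s\<in>{0..t}. ennreal (if Q s < N then v s else 0) \<partial>lborel)"
        using below n by auto
    qed
  qed
qed

section \<open>The moment bound for Ito processes\<close>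

text \<open>\<open>c0\<close> and \<open>c1\<close> are the coefficients in
  \<open>square_pathwise_bound\<close>, \<open>C1\<close> the resulting Gronwall factor;
  \<open>k2\<close> comes from k^2 (1+x)^2 \<le> 2 k^2 (1+x^2). With w t = E[min (Q t) N],
  \<open>w0\<close> and \<open>c2\<close> are the coefficients in the bound of w t by w0 plus c2
  times the integral of w over [0,t], and \<open>L\<close> bounds the integral of w over [0,T].
  Neither the control nor N enters.\<close>

definition second_moment_constant :: "real \<Rightarrow> real \<Rightarrow> real \<Rightarrow> real" where
  "second_moment_constant D T k =
    (let c0 = 3 * k\<^sup>2 * (1 + T)\<^sup>2; c1 = 3 * k\<^sup>2 * T; k2 = 2 * k\<^sup>2; C1 = 2 * exp (2 * c1 * T);
         w0 = k2 * T + k2 * (C1 * (c0 * T)); c2 = k2 * (C1 * (3 * D));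
         L = 2 * exp (2 * c2 * T) * (w0 * T)
     in c0 + 3 * D * (w0 + c2 * L) + c1 * (C1 * (c0 * T + 3 * D * L)))"

context brownian_filtration
begin

text \<open>Abstracts from the equation: what enters is linear growth of H in X and a pathwise bound
  of X by its own time integral and I. The first use of Gronwall is for a fixed path, where
  continuity gives finiteness; the second is for expectations, where truncation does.\<close>

lemma ito_process_second_moment:
  fixes H :: "real \<Rightarrow> 'w \<Rightarrow> real ^ 'd ^ 'n" and I X :: "real \<Rightarrow> 'w \<Rightarrow> real ^ 'n" and k :: real
  assumes T: "0 < T" and k: "0 < k"
    and ito: "is_ito_integral M T F W H I"
    and X_meas: "\<And>t. t \<in> {0..T} \<Longrightarrow> X t \<in> borel_measurable M"
    and X_cont: "continuous_paths M T X" and I_cont: "continuous_paths M T I"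
    and H_le: "AE \<omega> in M. \<forall>t\<in>{0..T}. norm (H t \<omega>) \<le> k * (1 + norm (X t \<omega>))"
    and X_le: "AE \<omega> in M. \<forall>t\<in>{0..T}.
      norm (X t \<omega>) \<le> k * (1 + (LINT s:{0..t}|lborel. 1 + norm (X s \<omega>))) + norm (I t \<omega>)"
  shows "(\<integral>\<^sup>+\<omega>. ennreal ((norm (X T \<omega>))\<^sup>2) \<partial>M) \<le> ennreal (second_moment_constant CARD('d) T k)"
proof -
  define D c0 c1 k2 where "D = real CARD('d)" and "c0 = 3 * k\<^sup>2 * (1 + T)\<^sup>2" and "c1 = 3 * k\<^sup>2 * T" and "k2 = 2 * k\<^sup>2"
  define C1 where "C1 = 2 * exp (2 * c1 * T)"
  define w0 c2 where "w0 = k2 * T + k2 * (C1 * (c0 * T))" and "c2 = k2 * (C1 * (3 * D))"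
  define L where "L = 2 * exp (2 * c2 * T) * (w0 * T)"
  have T0: "0 \<le> T" using T by simp
  have pos: "0 < D" "0 < c0" "0 < c1" "0 < k2" "0 < C1" "0 < w0" "0 < c2" "0 < L"
    using T k by (simp_all add: D_def c0_def c1_def k2_def C1_def w0_def c2_def L_def add_pos_pos)
  then have nonneg: "0 \<le> D" "0 \<le> c0" "0 \<le> c1" "0 \<le> k2" "0 \<le> C1" "0 \<le> w0" "0 \<le> c2" "0 \<le> L"
    by simp_all
  obtain Q where Q_meas[measurable]: "(\<lambda>(t, \<omega>). Q t \<omega>) \<in> borel_measurable (borel \<Otimes>\<^sub>M M)"
    and Q_eq: "AE \<omega> in M. \<forall>t\<in>{0..T}. Q t \<omega> = (LINT s:{0..t}|lborel. (norm (H s \<omega>))\<^sup>2)"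
    and Q_ito: "\<And>t N. t \<in> {0..T} \<Longrightarrow> 0 \<le> N \<Longrightarrow>
      (\<integral>\<^sup>+\<omega>. ennreal (indicator {x. Q t x < N} \<omega> * (norm (I t \<omega>))\<^sup>2) \<partial>M)
        \<le> CARD('d) * (\<integral>\<^sup>+\<omega>. ennreal (min (Q t \<omega>) N) \<partial>M)"
    using ito_integral_second_moment[OF ito] by blast
  \<comment> \<open>X and I are replaced by jointly measurable versions because time integral and
    expectation are exchanged below.\<close>
  obtain X' where X'_meas[measurable]: "(\<lambda>(t, \<omega>). X' t \<omega>) \<in> borel_measurable (borel \<Otimes>\<^sub>M M)"
    and X'_eq: "AE \<omega> in M. \<forall>t\<in>{0..T}. X' t \<omega> = X t \<omega>"
    using continuous_paths_measurable_version[OF T0 X_meas X_cont] by blast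
  have I_meas: "I t \<in> borel_measurable M" if "t \<in> {0..T}" for t
    using ito that unfolding is_ito_integral_def tendsto_in_probability_def by blast
  obtain I' where I'_meas[measurable]: "(\<lambda>(t, \<omega>). I' t \<omega>) \<in> borel_measurable (borel \<Otimes>\<^sub>M M)"
    and I'_eq: "AE \<omega> in M. \<forall>t\<in>{0..T}. I' t \<omega> = I t \<omega>"
    using continuous_paths_measurable_version[OF T0 I_meas I_cont] by blast
  have H_int: "AE \<omega> in M. set_integrable lborel {0..T} (\<lambda>s. (norm (H s \<omega>))\<^sup>2)"
    using ito unfolding is_ito_integral_def by (auto elim: eventually_mono)
  interpret LM: pair_sigma_finite lborel M by unfold_locales
  have sets_LM[measurable_cong]: "sets (lborel \<Otimes>\<^sub>M M) = sets (borel \<Otimes>\<^sub>M M)"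
    by (intro sets_pair_measure_cong) auto
  have "(\<integral>\<^sup>+\<omega>. ennreal (if Q T \<omega> < N then (norm (X' T \<omega>))\<^sup>2 else 0) \<partial>M)
      \<le> ennreal (c0 + 3 * D * (w0 + c2 * L) + c1 * (C1 * (c0 * T + 3 * D * L)))" if N: "0 < N" for N
  proof -
    define U where "U s \<omega> = ennreal (if Q s \<omega> < N then (norm (X' s \<omega>))\<^sup>2 else 0)" for s \<omega>
    define Y where "Y s \<omega> = ennreal (if Q s \<omega> < N then 3 * (norm (I' s \<omega>))\<^sup>2 else 0)" for s \<omega>
    define w where "w s = (\<integral>\<^sup>+\<omega>. ennreal (min (Q s \<omega>) N) \<partial>M)" for s
    have U_meas[measurable]: "(\<lambda>(s, \<omega>). U s \<omega>) \<in> borel_measurable (borel \<Otimes>\<^sub>M M)"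
      unfolding U_def by measurable
    have Y_meas[measurable]: "(\<lambda>(s, \<omega>). Y s \<omega>) \<in> borel_measurable (borel \<Otimes>\<^sub>M M)"
      unfolding Y_def by measurable
    have w_meas[measurable]: "w \<in> borel_measurable borel"
      unfolding w_def by measurable
    have w_N: "w s \<le> ennreal N" for s
    proof -
      have "w s \<le> (\<integral>\<^sup>+\<omega>. ennreal N \<partial>M)"
        unfolding w_def by (intro nn_integral_mono ennreal_leI) auto
      then show ?thesis by (simp add: emeasure_space_1)
    qed
    have interval: "(\<integral>\<^sup>+s\<in>{0..t}. ennreal c \<partial>lborel) = ennreal (c * t)" if "0 \<le> t" "0 \<le> c" for c t
      using that by (simp add: nn_integral_cmult ennreal_mult)
    \<comment> \<open>A real-valued copy of the integral of w, finite by w \<le> N, so that the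
      constants are handled in the reals.\<close>
    define J where "J t = enn2real (\<integral>\<^sup>+s\<in>{0..t}. w s \<partial>lborel)" for t
    have J: "(\<integral>\<^sup>+s\<in>{0..t}. w s \<partial>lborel) = ennreal (J t)" "0 \<le> J t" if "0 \<le> t" for t
    proof -
      have "(\<integral>\<^sup>+s\<in>{0..t}. w s \<partial>lborel) \<le> (\<integral>\<^sup>+s\<in>{0..t}. ennreal N \<partial>lborel)"
        using w_N by (intro nn_integral_mono mult_right_mono) auto
      also have "\<dots> < \<top>" using that N by (simp add: interval)
      finally show "(\<integral>\<^sup>+s\<in>{0..t}. w s \<partial>lborel) = ennreal (J t)"
        unfolding J_def by simp
    qed (simp add: J_def)
    have Y_le: "(\<integral>\<^sup>+\<omega>. Y s \<omega> \<partial>M) \<le> ennreal (3 * D) * w s" if s: "s \<in> {0..T}" for s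
    proof -
      have [measurable]: "I s \<in> borel_measurable M" using I_meas[OF s] .
      have "(\<integral>\<^sup>+\<omega>. Y s \<omega> \<partial>M) = (\<integral>\<^sup>+\<omega>. ennreal 3 * ennreal (indicator {x. Q s x < N} \<omega> * (norm (I s \<omega>))\<^sup>2) \<partial>M)"
      proof (rule nn_integral_cong_AE)
        show "AE \<omega> in M. Y s \<omega> = ennreal 3 * ennreal (indicator {x. Q s x < N} \<omega> * (norm (I s \<omega>))\<^sup>2)"
          using I'_eq by eventually_elim (use s in \<open>auto simp: Y_def ennreal_mult\<close>)
      qed
      also have "\<dots> = ennreal 3 * (\<integral>\<^sup>+\<omega>. ennreal (indicator {x. Q s x < N} \<omega> * (norm (I s \<omega>))\<^sup>2) \<partial>M)"
        by (intro nn_integral_cmult) (simp add: indicator_def)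
      also have "\<dots> \<le> ennreal 3 * (CARD('d) * w s)"
        using Q_ito[OF s, of N] N unfolding w_def by (intro mult_left_mono) auto
      also have "\<dots> = ennreal (3 * D) * w s"
        unfolding D_def by (simp add: ennreal_mult ennreal_of_nat_eq_real_of_nat mult.assoc)
      finally show ?thesis .
    qed
    \<comment> \<open>One almost sure event carries all that is used along paths: the Gronwall
      inequality for U, its finiteness hypothesis, and the bound of the truncated Q by U that later
      closes the loop.\<close>
    have pathwise: "AE \<omega> in M. (\<forall>t\<in>{0..T}. U t \<omega> \<le> (ennreal c0 + Y t \<omega>) + c1 * (\<integral>\<^sup>+s\<in>{0..t}. U s \<omega> \<partial>lborel)) \<and>
        (\<integral>\<^sup>+s\<in>{0..T}. U s \<omega> \<partial>lborel) < \<infinity> \<and>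
        (\<forall>t\<in>{0..T}. ennreal (min (Q t \<omega>) N) \<le> (\<integral>\<^sup>+s\<in>{0..t}. (ennreal k2 * (1 + U s \<omega>)) \<partial>lborel))"
      using Q_eq X'_eq I'_eq H_int H_le X_le X_cont[unfolded continuous_paths_def]
    proof eventually_elim
      case (elim \<omega>)
      define x where "x s = norm (X s \<omega>)" for s
      have x_cont: "continuous_on {0..T} x"
        unfolding x_def using elim(7) by (intro continuous_intros)
      have Q_mono: "Q s \<omega> \<le> Q t \<omega>" if "0 \<le> s" "s \<le> t" "t \<le> T" for s t
      proof -
        have "set_integrable lborel {0..r} (\<lambda>s. (norm (H s \<omega>))\<^sup>2)" if "r \<le> T" for r
          using elim(4) that by (auto intro: set_integrable_subset)
        from this[of s] this[of t]
        have "(LINT u:{0..s}|lborel. (norm (H u \<omega>))\<^sup>2) \<le> (LINT u:{0..t}|lborel. (norm (H u \<omega>))\<^sup>2)"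
          using that unfolding set_lebesgue_integral_def set_integrable_def
          by (intro integral_mono) (auto simp: indicator_def)
        then show ?thesis using that elim(1) by simp
      qed
      have U_le: "U s \<omega> \<le> ennreal ((x s)\<^sup>2)" if "s \<in> {0..T}" for s
        using elim(2) that by (auto simp: U_def x_def)
      have "U t \<omega> \<le> (ennreal c0 + Y t \<omega>) + c1 * (\<integral>\<^sup>+s\<in>{0..t}. U s \<omega> \<partial>lborel)" if t: "t \<in> {0..T}" for t
      \<comment> \<open>If Q t < N, monotonicity of Q makes the truncation inactive on all of [0,t],
        so U is the square of x there; otherwise U t is zero.\<close>
      proof (cases "Q t \<omega> < N")
        case True
        have U_eq: "U s \<omega> = ennreal ((x s)\<^sup>2)" if "s \<in> {0..t}" for s
          using elim(2) that t Q_mono[of s t] True by (auto simp: U_def x_def)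
        have "ennreal ((x t)\<^sup>2) \<le> ennreal (3 * k\<^sup>2 * (1 + T)\<^sup>2 + 3 * (norm (I t \<omega>))\<^sup>2)
            + ennreal (3 * k\<^sup>2 * T) * (\<integral>\<^sup>+s\<in>{0..t}. ennreal ((x s)\<^sup>2) \<partial>lborel)"
          using elim(6) t k by (intro square_pathwise_bound[OF x_cont]) (auto simp: x_def)
        also have "(\<integral>\<^sup>+s\<in>{0..t}. ennreal ((x s)\<^sup>2) \<partial>lborel) = (\<integral>\<^sup>+s\<in>{0..t}. U s \<omega> \<partial>lborel)"
          using U_eq by (intro nn_integral_cong) (auto simp: indicator_def)
        also have "ennreal (3 * k\<^sup>2 * (1 + T)\<^sup>2 + 3 * (norm (I t \<omega>))\<^sup>2) = ennreal c0 + Y t \<omega>"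
          using True elim(3) t nonneg by (simp add: Y_def c0_def ennreal_plus)
        finally show ?thesis
          using U_eq[of t] t unfolding c1_def by simp
      next
        case False
        then show ?thesis by (simp add: U_def)
      qed
      moreover have "(\<integral>\<^sup>+s\<in>{0..T}. U s \<omega> \<partial>lborel) < \<infinity>"
      proof -
        have "(\<integral>\<^sup>+s\<in>{0..T}. U s \<omega> \<partial>lborel) \<le> (\<integral>\<^sup>+s\<in>{0..T}. ennreal ((x s)\<^sup>2) \<partial>lborel)"
          using U_le by (intro nn_integral_mono) (auto simp: indicator_def)
        also have "\<dots> = ennreal (LINT s:{0..T}|lborel. (x s)\<^sup>2)"
          using x_cont by (intro nn_integral_set_eq_integral borel_integrable_atLeastAtMost' continuous_intros) auto
        finally show ?thesis by (auto simp: le_less_trans)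
      qed
      moreover have "ennreal (min (Q t \<omega>) N) \<le> (\<integral>\<^sup>+s\<in>{0..t}. (ennreal k2 * (1 + U s \<omega>)) \<partial>lborel)"
        if t: "t \<in> {0..T}" for t
      proof -
        have sq: "(norm (H s \<omega>))\<^sup>2 \<le> k2 * (1 + (x s)\<^sup>2)" if "s \<in> {0..T}" for s
        proof -
          have "(norm (H s \<omega>))\<^sup>2 \<le> (k * (1 + x s))\<^sup>2"
            using elim(5) that by (intro power_mono) (auto simp: x_def)
          also have "\<dots> = k\<^sup>2 * (1 + x s)\<^sup>2" by (rule power_mult_distrib)
          also have "\<dots> \<le> k\<^sup>2 * (2 * (1 + (x s)\<^sup>2))"
            using zero_le_power2[of "x s - 1"] by (intro mult_left_mono) (auto simp: power2_eq_square algebra_simps)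
          finally show ?thesis by (simp add: k2_def algebra_simps)
        qed
        have "ennreal (min (Q t \<omega>) N) \<le>
            (\<integral>\<^sup>+s\<in>{0..t}. ennreal (if Q s \<omega> < N then k2 * (1 + (x s)\<^sup>2) else 0) \<partial>lborel)"
          using elim(1) sq t N by (intro min_integral_le_truncated[OF elim(4)]) auto
        \<comment> \<open>The constant 1 is kept even where the truncation is active, at a cost of
          at most k2 T.\<close>
        also have "\<dots> \<le> (\<integral>\<^sup>+s\<in>{0..t}. (ennreal k2 * (1 + U s \<omega>)) \<partial>lborel)"
        proof (rule nn_integral_mono)
          fix s
          show "ennreal (if Q s \<omega> < N then k2 * (1 + (x s)\<^sup>2) else 0) * indicator {0..t} s
              \<le> ennreal k2 * (1 + U s \<omega>) * indicator {0..t} s"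
            using elim(2) t nonneg
            by (auto simp: indicator_def U_def x_def ennreal_mult ennreal_plus)
        qed
        finally show ?thesis .
      qed
      ultimately show ?case by blast
    qed
    define V where "V t = (\<integral>\<^sup>+\<omega>. (\<integral>\<^sup>+s\<in>{0..t}. U s \<omega> \<partial>lborel) \<partial>M)" for t
    have V_le: "V t \<le> ennreal (C1 * (c0 * T + 3 * D * J t))" if t: "t \<in> {0..T}" for t
    proof -
      have "V t \<le> (\<integral>\<^sup>+\<omega>. ennreal C1 * (\<integral>\<^sup>+s\<in>{0..t}. (ennreal c0 + Y s \<omega>) \<partial>lborel) \<partial>M)"
        unfolding V_def
      proof (rule nn_integral_mono_AE)
        show "AE \<omega> in M. (\<integral>\<^sup>+s\<in>{0..t}. U s \<omega> \<partial>lborel)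
            \<le> ennreal C1 * (\<integral>\<^sup>+s\<in>{0..t}. (ennreal c0 + Y s \<omega>) \<partial>lborel)"
          using pathwise AE_space
        proof eventually_elim
          case (elim \<omega>)
          have [measurable]: "(\<lambda>s. U s \<omega>) \<in> borel_measurable borel" "(\<lambda>s. Y s \<omega>) \<in> borel_measurable borel"
            using measurable_compose[OF measurable_Pair2'[OF elim(2)] U_meas]
              measurable_compose[OF measurable_Pair2'[OF elim(2)] Y_meas] by simp_all
          show ?case
            unfolding C1_def by (rule gronwall_nn_integral) (use elim pos t in auto)
        qed
      qed
      also have "\<dots> = ennreal C1 * (\<integral>\<^sup>+\<omega>. (\<integral>\<^sup>+s\<in>{0..t}. (ennreal c0 + Y s \<omega>) \<partial>lborel) \<partial>M)"
        by (rule nn_integral_cmult) measurable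
      finally have *: "V t \<le> ennreal C1 * (\<integral>\<^sup>+\<omega>. (\<integral>\<^sup>+s\<in>{0..t}. (ennreal c0 + Y s \<omega>) \<partial>lborel) \<partial>M)" .
      have "(\<integral>\<^sup>+\<omega>. (\<integral>\<^sup>+s\<in>{0..t}. (ennreal c0 + Y s \<omega>) \<partial>lborel) \<partial>M)
          = (\<integral>\<^sup>+s. (\<integral>\<^sup>+\<omega>. (ennreal c0 + Y s \<omega>) * indicator {0..t} s \<partial>M) \<partial>lborel)"
        by (rule LM.Fubini') measurable
      also have "\<dots> \<le> (\<integral>\<^sup>+s. ennreal c0 * indicator {0..t} s + ennreal (3 * D) * (w s * indicator {0..t} s) \<partial>lborel)"
      proof (rule nn_integral_mono)
        fix s
        have [measurable]: "Y s \<in> borel_measurable M"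
          using measurable_compose[OF measurable_Pair1' Y_meas, of s] by simp
        show "(\<integral>\<^sup>+\<omega>. (ennreal c0 + Y s \<omega>) * indicator {0..t} s \<partial>M)
            \<le> ennreal c0 * indicator {0..t} s + ennreal (3 * D) * (w s * indicator {0..t} s)"
        proof (cases "s \<in> {0..t}")
          case True
          then show ?thesis
            using Y_le[of s] t by (simp add: nn_integral_add emeasure_space_1)
        qed simp
      qed
      also have "\<dots> = ennreal (c0 * t) + ennreal (3 * D) * ennreal (J t)"
        using J t nonneg by (simp add: nn_integral_add nn_integral_cmult ennreal_mult)
      also have "\<dots> = ennreal (c0 * t + 3 * D * J t)"
        using J t nonneg by (simp add: ennreal_mult ennreal_plus)
      also have "\<dots> \<le> ennreal (c0 * T + 3 * D * J t)"
        using t nonneg by (intro ennreal_leI add_right_mono mult_left_mono) auto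
      finally have "V t \<le> ennreal C1 * ennreal (c0 * T + 3 * D * J t)"
        using order_trans[OF * mult_left_mono] by simp
      then show ?thesis
        using nonneg by (simp add: ennreal_mult')
    qed
    \<comment> \<open>The bound of \<open>V\<close> by the integral of w feeds back into w and
      leaves an inequality in w alone, ready for the second use of Gronwall.\<close>
    have w_le: "w t \<le> ennreal w0 + ennreal c2 * (\<integral>\<^sup>+s\<in>{0..t}. w s \<partial>lborel)" if t: "t \<in> {0..T}" for t
    proof -
      have "w t \<le> (\<integral>\<^sup>+\<omega>. (\<integral>\<^sup>+s\<in>{0..t}. (ennreal k2 * (1 + U s \<omega>)) \<partial>lborel) \<partial>M)"
        unfolding w_def
        by (rule nn_integral_mono_AE) (use pathwise in eventually_elim, use t in blast)
      also have "\<dots> = (\<integral>\<^sup>+\<omega>. ennreal k2 * (ennreal t + (\<integral>\<^sup>+s\<in>{0..t}. U s \<omega> \<partial>lborel)) \<partial>M)"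
      proof (rule nn_integral_cong)
        fix \<omega> assume \<omega>: "\<omega> \<in> space M"
        have [measurable]: "(\<lambda>s. U s \<omega>) \<in> borel_measurable borel"
          using measurable_compose[OF measurable_Pair2'[OF \<omega>] U_meas] by simp
        show "(\<integral>\<^sup>+s\<in>{0..t}. (ennreal k2 * (1 + U s \<omega>)) \<partial>lborel)
            = ennreal k2 * (ennreal t + (\<integral>\<^sup>+s\<in>{0..t}. U s \<omega> \<partial>lborel))"
          using t by (simp add: mult.assoc nn_integral_cmult distrib_right nn_integral_add)
      qed
      also have "\<dots> = ennreal k2 * (ennreal t + V t)"
        unfolding V_def by (simp add: nn_integral_cmult nn_integral_add emeasure_space_1)
      also have "\<dots> \<le> ennreal k2 * (ennreal T + ennreal (C1 * (c0 * T + 3 * D * J t)))"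
        using t V_le[OF t] by (intro mult_left_mono add_mono) (auto intro: ennreal_leI)
      also have "\<dots> = ennreal (w0 + c2 * J t)"
        using nonneg J(2)[of t] t T0 unfolding w0_def c2_def
        by (simp flip: ennreal_plus ennreal_mult) (simp add: algebra_simps)
      also have "\<dots> = ennreal w0 + ennreal c2 * ennreal (J t)"
        using nonneg J(2)[of t] t by (simp add: ennreal_mult ennreal_plus)
      finally show ?thesis using J(1)[of t] t by simp
    qed
    have "ennreal (J T) \<le> ennreal (2 * exp (2 * c2 * T)) * (\<integral>\<^sup>+s\<in>{0..T}. ennreal w0 \<partial>lborel)"
      unfolding J(1)[OF T0, symmetric] using w_le J(1)[OF T0] pos T0
      by (intro gronwall_nn_integral) auto
    also have "\<dots> = ennreal L"
      unfolding interval[OF T0 nonneg(6)] L_def using nonneg T0 by (simp add: ennreal_mult)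
    finally have J_L: "J T \<le> L"
      using nonneg by (simp add: ennreal_le_iff)
    \<comment> \<open>Gronwall has bounded time integrals only; the value at T is recovered from the
      pathwise inequality taken at t = T.\<close>
    have "(\<integral>\<^sup>+\<omega>. U T \<omega> \<partial>M) \<le>
        (\<integral>\<^sup>+\<omega>. (ennreal c0 + Y T \<omega>) + ennreal c1 * (\<integral>\<^sup>+s\<in>{0..T}. U s \<omega> \<partial>lborel) \<partial>M)"
      by (rule nn_integral_mono_AE) (use pathwise in eventually_elim, use T0 in auto)
    also have "\<dots> = ennreal c0 + (\<integral>\<^sup>+\<omega>. Y T \<omega> \<partial>M) + ennreal c1 * V T"
    proof -
      have [measurable]: "Y T \<in> borel_measurable M"
        using measurable_compose[OF measurable_Pair1' Y_meas, of T] by simp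
      show ?thesis
        unfolding V_def by (simp add: nn_integral_cmult nn_integral_add emeasure_space_1)
    qed
    also have "\<dots> \<le> ennreal c0 + ennreal (3 * D) * ennreal (w0 + c2 * L) + ennreal c1 * ennreal (C1 * (c0 * T + 3 * D * L))"
    proof (intro add_mono mult_left_mono order_refl)
      have "w T \<le> ennreal (w0 + c2 * J T)"
        using w_le[of T] J[OF T0] T0 nonneg by (simp add: ennreal_mult ennreal_plus)
      also have "\<dots> \<le> ennreal (w0 + c2 * L)"
        using J_L nonneg by (intro ennreal_leI add_left_mono mult_left_mono)
      finally have "w T \<le> ennreal (w0 + c2 * L)" .
      then show "(\<integral>\<^sup>+\<omega>. Y T \<omega> \<partial>M) \<le> ennreal (3 * D) * ennreal (w0 + c2 * L)"
        using order_trans[OF Y_le mult_left_mono] T0 by simp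
      have "V T \<le> ennreal (C1 * (c0 * T + 3 * D * J T))"
        using V_le[of T] T0 by simp
      also have "\<dots> \<le> ennreal (C1 * (c0 * T + 3 * D * L))"
        using J_L nonneg by (intro ennreal_leI add_left_mono mult_left_mono) auto
      finally show "V T \<le> ennreal (C1 * (c0 * T + 3 * D * L))" .
    qed simp
    also have "\<dots> = ennreal (c0 + 3 * D * (w0 + c2 * L) + c1 * (C1 * (c0 * T + 3 * D * L)))"
      using nonneg T0 by (simp flip: ennreal_plus ennreal_mult)
    finally show ?thesis unfolding U_def .
  qed
  note truncated = this
  have [measurable]: "Q T \<in> borel_measurable M" "X' T \<in> borel_measurable M"
    using measurable_compose[OF measurable_Pair1' Q_meas, of T] measurable_compose[OF measurable_Pair1' X'_meas, of T]
    by simp_all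
  \<comment> \<open>Fatou's lemma removes the truncation, since for each \<omega> the level n + 1
    eventually exceeds Q T. The shift by one keeps the level positive.\<close>
  have "(\<integral>\<^sup>+\<omega>. ennreal ((norm (X T \<omega>))\<^sup>2) \<partial>M)
      \<le> (\<integral>\<^sup>+\<omega>. liminf (\<lambda>n. ennreal (if Q T \<omega> < real (Suc n) then (norm (X' T \<omega>))\<^sup>2 else 0)) \<partial>M)"
  proof (rule nn_integral_mono_AE)
    show "AE \<omega> in M. ennreal ((norm (X T \<omega>))\<^sup>2) \<le>
        liminf (\<lambda>n. ennreal (if Q T \<omega> < real (Suc n) then (norm (X' T \<omega>))\<^sup>2 else 0))"
      using X'_eq
    proof eventually_elim
      case (elim \<omega>)
      obtain m where m: "Q T \<omega> < real m" using reals_Archimedean2 by blast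
      have "eventually (\<lambda>n. ennreal ((norm (X T \<omega>))\<^sup>2) \<le> ennreal (if Q T \<omega> < real (Suc n) then (norm (X' T \<omega>))\<^sup>2 else 0)) sequentially"
        using eventually_ge_at_top[of m]
        by eventually_elim (use m elim T0 in auto)
      then show ?case by (rule Liminf_bounded)
    qed
  qed
  also have "\<dots> \<le> liminf (\<lambda>n. \<integral>\<^sup>+\<omega>. ennreal (if Q T \<omega> < real (Suc n) then (norm (X' T \<omega>))\<^sup>2 else 0) \<partial>M)"
    by (rule nn_integral_liminf) measurable
  also have "\<dots> \<le> liminf (\<lambda>n. ennreal (c0 + 3 * D * (w0 + c2 * L) + c1 * (C1 * (c0 * T + 3 * D * L))))"
    using truncated by (intro Liminf_mono always_eventually allI) simp
  also have "\<dots> = ennreal (second_moment_constant CARD('d) T k)"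
    by (simp add: Liminf_const second_moment_constant_def Let_def D_def c0_def c1_def k2_def C1_def w0_def c2_def L_def)
  finally show ?thesis .
qed

end

text \<open>Boundedness of \<AA> removes the dependence on the control: |a| \<le> a0 turns the
  growth condition into linear growth in x with a constant common to all controls, so one C serves
  them all.\<close>

lemma (in brownian_filtration) controlled_diffusion_second_moment:
  fixes \<mu> :: "(real ^ 'n) \<times> 'c::euclidean_space \<Rightarrow> real ^ 'n" and \<sigma> :: "(real ^ 'n) \<times> 'c \<Rightarrow> real ^ 'd ^ 'n"
  assumes T: "0 < T" and K: "0 < K" and bdd: "bounded \<AA>"
    and growth: "\<And>x a. a \<in> \<AA> \<Longrightarrow> norm (\<mu> (x, a)) + norm (\<sigma> (x, a)) \<le> K * (1 + norm x + norm a)"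
  obtains C :: real where "0 \<le> C"
    "\<And>A X. A \<in> admissible_controls M T F \<AA> \<Longrightarrow> strong_solution M T F W \<mu> \<sigma> x0 A X \<Longrightarrow>
      (\<integral>\<^sup>+\<omega>. ennreal ((norm (X T \<omega>))\<^sup>2) \<partial>M) \<le> ennreal C"
proof -
  obtain a0 where a0: "\<And>a. a \<in> \<AA> \<Longrightarrow> norm a \<le> a0" "0 < a0"
    using bdd unfolding bounded_pos by blast
  \<comment> \<open>K (1 + a0) bounds both coefficients, and the summand \<open>norm x0\<close>
    absorbs the initial value.\<close>
  define k where "k = K * (1 + a0) + norm x0"
  have k: "0 < k" using K a0(2) by (simp add: k_def add_pos_nonneg)
  have coeff: "norm (\<mu> (x, a)) \<le> k * (1 + norm x)" "norm (\<sigma> (x, a)) \<le> k * (1 + norm x)" if "a \<in> \<AA>" for x a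
  proof -
    have "K * (1 + norm x + norm a) \<le> K * ((1 + a0) * (1 + norm x))"
      using K a0 that by (intro mult_left_mono) (auto simp: algebra_simps add_increasing2)
    also have "\<dots> \<le> k * (1 + norm x)"
      unfolding k_def mult.assoc[symmetric] by (intro mult_right_mono) auto
    finally show "norm (\<mu> (x, a)) \<le> k * (1 + norm x)" "norm (\<sigma> (x, a)) \<le> k * (1 + norm x)"
      using growth[OF that, of x] norm_ge_zero[of "\<mu> (x, a)"] norm_ge_zero[of "\<sigma> (x, a)"] by linarith+
  qed
  note bound = ito_process_second_moment[OF T k]
  show thesis
  proof (rule that)
    show "0 \<le> max (second_moment_constant CARD('d) T k) 0" by simp
    fix A and X :: "real \<Rightarrow> 'w \<Rightarrow> real ^ 'n"
    assume A: "A \<in> admissible_controls M T F \<AA>" and X: "strong_solution M T F W \<mu> \<sigma> x0 A X"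
    obtain I where I: "is_ito_integral M T F W (\<lambda>s \<omega>. \<sigma> (X s \<omega>, A s \<omega>)) I"
      and X_eq: "AE \<omega> in M. \<forall>t\<in>{0..T}. X t \<omega> = x0 + (LINT s:{0..t}|lborel. \<mu> (X s \<omega>, A s \<omega>)) + I t \<omega>"
      using X unfolding strong_solution_def by blast
    have X_cont: "continuous_paths M T X"
      and \<mu>_int: "AE \<omega> in M. set_integrable lborel {0..T} (\<lambda>s. \<mu> (X s \<omega>, A s \<omega>))"
      using X unfolding strong_solution_def by auto
    have X_meas: "X t \<in> borel_measurable M" if "t \<in> {0..T}" for t
      using X that by (intro measurable_F_M[of _ t]) (auto simp: strong_solution_def adapted_def)
    have A_in: "AE \<omega> in M. \<forall>t\<in>{0..T}. A t \<omega> \<in> \<AA>"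
      using A by (simp add: admissible_controls_def)
    \<comment> \<open>\<open>is_ito_integral\<close> determines \<open>I t\<close> only up to a null
      set for each t; continuity of its paths is read off from the equation, in which all other
      terms are continuous.\<close>
    have I_cont: "continuous_paths M T I"
      unfolding continuous_paths_def using X_eq \<mu>_int X_cont[unfolded continuous_paths_def]
    proof eventually_elim
      case (elim \<omega>)
      have "continuous_on {0..T} (\<lambda>t. X t \<omega> - x0 - (LINT s:{0..t}|lborel. \<mu> (X s \<omega>, A s \<omega>)))"
        using elim by (intro continuous_intros continuous_on_set_integral)
      then show ?case
        by (rule continuous_on_eq) (use elim(1) in auto)
    qed
    have \<sigma>_le: "AE \<omega> in M. \<forall>t\<in>{0..T}. norm (\<sigma> (X t \<omega>, A t \<omega>)) \<le> k * (1 + norm (X t \<omega>))"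
      using A_in by eventually_elim (auto intro: coeff)
    have X_le: "AE \<omega> in M. \<forall>t\<in>{0..T}.
        norm (X t \<omega>) \<le> k * (1 + (LINT s:{0..t}|lborel. 1 + norm (X s \<omega>))) + norm (I t \<omega>)"
      using X_eq \<mu>_int X_cont[unfolded continuous_paths_def] A_in
    proof eventually_elim
      case (elim \<omega>)
      show ?case
      proof
        fix t assume t: "t \<in> {0..T}"
        have "continuous_on {0..t} (\<lambda>s. 1 + norm (X s \<omega>))"
          using t continuous_on_subset[OF elim(3), of "{0..t}"] by (auto intro!: continuous_intros)
        then have int: "set_integrable lborel {0..t} (\<lambda>s. \<mu> (X s \<omega>, A s \<omega>))"
          "set_integrable lborel {0..t} (\<lambda>s. 1 + norm (X s \<omega>))"
          using t by (auto intro: set_integrable_subset[OF elim(2)] borel_integrable_atLeastAtMost')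
        have "norm (LINT s:{0..t}|lborel. \<mu> (X s \<omega>, A s \<omega>)) \<le> (LINT s:{0..t}|lborel. norm (\<mu> (X s \<omega>, A s \<omega>)))"
          by (rule set_integral_norm_bound[OF int(1)])
        also have "\<dots> \<le> (LINT s:{0..t}|lborel. k * (1 + norm (X s \<omega>)))"
          using int elim(4) t by (intro set_integral_mono set_integrable_norm set_integrable_mult_right) (auto intro: coeff)
        also have "\<dots> = k * (LINT s:{0..t}|lborel. 1 + norm (X s \<omega>))"
          by simp
        finally have "norm (LINT s:{0..t}|lborel. \<mu> (X s \<omega>, A s \<omega>)) \<le> k * (LINT s:{0..t}|lborel. 1 + norm (X s \<omega>))" .
        moreover have "norm (X t \<omega>) \<le> norm x0 + norm (LINT s:{0..t}|lborel. \<mu> (X s \<omega>, A s \<omega>)) + norm (I t \<omega>)"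
          using elim(1) t by (auto intro: norm_triangle_le add_right_mono norm_triangle_ineq)
        moreover have "norm x0 \<le> k" using K a0(2) by (simp add: k_def)
        ultimately show "norm (X t \<omega>) \<le> k * (1 + (LINT s:{0..t}|lborel. 1 + norm (X s \<omega>))) + norm (I t \<omega>)"
          by (simp add: distrib_left)
      qed
    qed
    show "(\<integral>\<^sup>+\<omega>. ennreal ((norm (X T \<omega>))\<^sup>2) \<partial>M) \<le> ennreal (max (second_moment_constant CARD('d) T k) 0)"
      by (rule order_trans[OF bound[OF I X_meas X_cont I_cont \<sigma>_le X_le]]) (auto intro: ennreal_leI)
  qed
qed

section \<open>Convexity of the value function\<close>

text \<open>The lower bound depends on Z only through the moment bound C; applied to the terminal
  states of all controls, it bounds their expected costs from below at once.\<close>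

lemma (in prob_space) quadratic_growth_expectation:
  fixes Z :: "'a \<Rightarrow> 'b::euclidean_space" and h :: "'b \<Rightarrow> real"
  assumes Z[measurable]: "Z \<in> borel_measurable M" and h[measurable]: "h \<in> borel_measurable borel"
    and growth: "\<And>z. \<bar>h z\<bar> \<le> B * (1 + (norm z)\<^sup>2)"
    and C: "0 \<le> C" "(\<integral>\<^sup>+\<omega>. ennreal ((norm (Z \<omega>))\<^sup>2) \<partial>M) \<le> ennreal C"
  shows "integrable M (\<lambda>\<omega>. h (Z \<omega>))" and "- (B * (1 + C)) \<le> expectation (\<lambda>\<omega>. h (Z \<omega>))"
proof -
  have B: "0 \<le> B"
    using order_trans[OF abs_ge_zero growth[of 0]] by simp
  have sq: "integrable M (\<lambda>\<omega>. (norm (Z \<omega>))\<^sup>2)"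
    using C by (intro integrableI_bounded) (auto intro: le_less_trans)
  have "ennreal (expectation (\<lambda>\<omega>. (norm (Z \<omega>))\<^sup>2)) \<le> ennreal C"
    using C(2) nn_integral_eq_integral[OF sq] by simp
  then have le: "expectation (\<lambda>\<omega>. (norm (Z \<omega>))\<^sup>2) \<le> C"
    using C(1) by simp
  show int: "integrable M (\<lambda>\<omega>. h (Z \<omega>))"
  proof (rule Bochner_Integration.integrable_bound)
    show "integrable M (\<lambda>\<omega>. B * (1 + (norm (Z \<omega>))\<^sup>2))" using sq by simp
    show "AE \<omega> in M. norm (h (Z \<omega>)) \<le> norm (B * (1 + (norm (Z \<omega>))\<^sup>2))"
      using growth B by simp
  qed simp
  have "- (B * (1 + C)) \<le> - (B * (1 + expectation (\<lambda>\<omega>. (norm (Z \<omega>))\<^sup>2)))"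
    using B le by (simp add: mult_left_mono)
  also have "\<dots> = expectation (\<lambda>\<omega>. - (B * (1 + (norm (Z \<omega>))\<^sup>2)))"
    using sq by (simp add: prob_space)
  also have "\<dots> \<le> expectation (\<lambda>\<omega>. h (Z \<omega>))"
  proof (rule integral_mono[OF _ int])
    show "integrable M (\<lambda>\<omega>. - (B * (1 + (norm (Z \<omega>))\<^sup>2)))" using sq by simp
    show "- (B * (1 + (norm (Z \<omega>))\<^sup>2)) \<le> h (Z \<omega>)" for \<omega>
      using growth[of "Z \<omega>"] by linarith
  qed
  finally show "- (B * (1 + C)) \<le> expectation (\<lambda>\<omega>. h (Z \<omega>))" .
qed

text \<open>Lipschitz continuity gives |g x| \<le> |g 0| + L |x|, and (a+b)^2 \<le> 2a^2 + 2b^2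
  preserves quadratic growth. The y-part is moved into the factor, since expectations are bounded
  for each fixed y.\<close>

lemma lipschitz_quadratic_growth:
  fixes g :: "'b::real_normed_vector \<Rightarrow> real" and f :: "real \<times> 'e::real_normed_vector \<Rightarrow> real"
  assumes C: "\<And>z y. \<bar>f (z, y)\<bar> \<le> C * (1 + \<bar>z\<bar>\<^sup>2 + (norm y)\<^sup>2)" and g: "L-lipschitz_on UNIV g"
  shows "\<bar>f (g x, y)\<bar> \<le> C * (1 + 2 * (g 0)\<^sup>2 + 2 * L\<^sup>2 + (norm y)\<^sup>2) * (1 + (norm x)\<^sup>2)"
proof -
  have C0: "0 \<le> C"
    using order_trans[OF abs_ge_zero C[of 0 0]] by simp
  have "\<bar>g x - g 0\<bar> \<le> L * norm x"
    using lipschitz_onD[OF g, of x 0] by (simp add: dist_norm)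
  then have "\<bar>g x\<bar> \<le> \<bar>g 0\<bar> + L * norm x" by linarith
  then have "\<bar>g x\<bar>\<^sup>2 \<le> (\<bar>g 0\<bar> + L * norm x)\<^sup>2" by (intro power_mono) auto
  also have "\<dots> \<le> 2 * (g 0)\<^sup>2 + 2 * L\<^sup>2 * (norm x)\<^sup>2"
    using zero_le_power2[of "\<bar>g 0\<bar> - L * norm x"]
    by (simp add: power2_diff power2_sum power_mult_distrib)
  finally have "1 + \<bar>g x\<bar>\<^sup>2 + (norm y)\<^sup>2 \<le> (1 + 2 * (g 0)\<^sup>2 + (norm y)\<^sup>2) * 1 + 2 * L\<^sup>2 * (norm x)\<^sup>2"
    by simp
  also have "\<dots> \<le> (1 + 2 * (g 0)\<^sup>2 + (norm y)\<^sup>2) * (1 + (norm x)\<^sup>2) + 2 * L\<^sup>2 * (1 + (norm x)\<^sup>2)"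
    by (intro add_mono mult_left_mono) auto
  also have "\<dots> = (1 + 2 * (g 0)\<^sup>2 + 2 * L\<^sup>2 + (norm y)\<^sup>2) * (1 + (norm x)\<^sup>2)"
    by (simp add: algebra_simps)
  finally show ?thesis
    using order_trans[OF C mult_left_mono[OF _ C0]] by (simp add: mult.assoc)
qed

section \<open>Mixing of controls and partial minimisation\<close>

lemma admissible_controls_convex_combination:
  assumes "convex \<AA>" "A \<in> admissible_controls M T F \<AA>" "A' \<in> admissible_controls M T F \<AA>" "\<theta> \<in> {0..1}"
  shows "(\<lambda>t \<omega>. \<theta> *\<^sub>R A t \<omega> + (1 - \<theta>) *\<^sub>R A' t \<omega>) \<in> admissible_controls M T F \<AA>"
proof -
  have "progressively_measurable T F (\<lambda>t \<omega>. \<theta> *\<^sub>R A t \<omega> + (1 - \<theta>) *\<^sub>R A' t \<omega>)"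
    using assms(2,3) unfolding admissible_controls_def progressively_measurable_def case_prod_beta
    by (auto intro!: borel_measurable_add borel_measurable_scaleR)
  moreover have "AE \<omega> in M. \<forall>t\<in>{0..T}. A t \<omega> \<in> \<AA>" "AE \<omega> in M. \<forall>t\<in>{0..T}. A' t \<omega> \<in> \<AA>"
    using assms(2,3) by (auto simp: admissible_controls_def)
  then have "AE \<omega> in M. \<forall>t\<in>{0..T}. \<theta> *\<^sub>R A t \<omega> + (1 - \<theta>) *\<^sub>R A' t \<omega> \<in> \<AA>"
    by eventually_elim (use assms(1,4) in \<open>auto intro!: convexD\<close>)
  ultimately show ?thesis by (simp add: admissible_controls_def)
qed

text \<open>Partial minimisation of a jointly convex family, with \<open>mix\<close> as the abstract
  form of joint convexity: two indices are answered by one mixed index. \<open>bdd\<close> ensures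
  that the infimum lies below every member of the family.\<close>

lemma convex_on_INF:
  fixes \<Phi> :: "'i \<Rightarrow> 'v::real_vector \<Rightarrow> real"
  assumes bdd: "\<And>y. bdd_below ((\<lambda>i. \<Phi> i y) ` \<I>)"
    and mix: "\<And>i j y y' \<theta>. i \<in> \<I> \<Longrightarrow> j \<in> \<I> \<Longrightarrow> \<theta> \<in> {0..1} \<Longrightarrow>
      \<exists>l\<in>\<I>. \<Phi> l (\<theta> *\<^sub>R y + (1 - \<theta>) *\<^sub>R y') \<le> \<theta> * \<Phi> i y + (1 - \<theta>) * \<Phi> j y'"
  shows "convex_on UNIV (\<lambda>y. INF i\<in>\<I>. \<Phi> i y)"
proof (cases "\<I> = {}")
  \<comment> \<open>Over the empty index set \<open>INF\<close> is one fixed real, so the function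
    is constant.\<close>
  case True
  then show ?thesis
    by (auto simp: convex_on_def simp flip: distrib_right)
next
  case False
  show ?thesis
  proof (rule convex_onI)
    fix \<theta> :: real and y y' :: 'v
    assume \<theta>: "0 < \<theta>" "\<theta> < 1"
    let ?V = "\<lambda>y. INF i\<in>\<I>. \<Phi> i y"
    have *: "?V ((1 - \<theta>) *\<^sub>R y + \<theta> *\<^sub>R y') \<le> (1 - \<theta>) * \<Phi> i y + \<theta> * \<Phi> j y'" if ij: "i \<in> \<I>" "j \<in> \<I>" for i j
    proof -
      obtain l where "l \<in> \<I>" "\<Phi> l ((1 - \<theta>) *\<^sub>R y + \<theta> *\<^sub>R y') \<le> (1 - \<theta>) * \<Phi> i y + \<theta> * \<Phi> j y'"
        using mix[OF ij, of "1 - \<theta>" y y'] \<theta> by auto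
      then show ?thesis
        using cINF_lower[OF bdd] order_trans by blast
    qed
    \<comment> \<open>The infimum is taken in one index at a time: with j fixed, division by the
      positive weight 1 - \<theta> isolates \<open>\<Phi> i y\<close>; then the same is done for
      j.\<close>
    have "(?V ((1 - \<theta>) *\<^sub>R y + \<theta> *\<^sub>R y') - \<theta> * \<Phi> j y') / (1 - \<theta>) \<le> ?V y" if "j \<in> \<I>" for j
      using False *[OF _ that] \<theta> by (intro cINF_greatest) (auto simp: field_simps)
    then have "(?V ((1 - \<theta>) *\<^sub>R y + \<theta> *\<^sub>R y') - (1 - \<theta>) * ?V y) / \<theta> \<le> ?V y'"
      using False \<theta> by (intro cINF_greatest) (auto simp: field_simps)
    then show "?V ((1 - \<theta>) *\<^sub>R y + \<theta> *\<^sub>R y') \<le> (1 - \<theta>) * ?V y + \<theta> * ?V y'"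
      using \<theta> by (simp add: field_simps)
  qed simp
qed

text \<open>Integrability and \<open>bdd_below\<close> belong to the conclusion because
  \<open>LINT\<close> and \<open>INF\<close> are total: they certify that the convex function
  obtained is the genuine infimum of genuine expectations.\<close>

theorem theorem2:
  fixes M :: "'w measure" and T K :: real
    and F :: "real \<Rightarrow> 'w measure"
    and W :: "real \<Rightarrow> 'w \<Rightarrow> real ^ 'd"
    and \<AA> :: "'c::euclidean_space set"
    and \<mu> :: "(real ^ 'n) \<times> 'c \<Rightarrow> real ^ 'n"
    and \<sigma> :: "(real ^ 'n) \<times> 'c \<Rightarrow> real ^ 'd ^ 'n"
    and x0 :: "real ^ 'n"
    and X :: "(real \<Rightarrow> 'w \<Rightarrow> 'c) \<Rightarrow> real \<Rightarrow> 'w \<Rightarrow> real ^ 'n"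
    and f :: "real \<times> (real ^ 'm) \<Rightarrow> real"
    and g :: "real ^ 'n \<Rightarrow> real"
  assumes "T > 0"
    and "prob_space M"
    and "usual_filtration M T F"
    and "brownian_motion M T F W"
    and "compact \<AA>"
    and "continuous_on (UNIV \<times> \<AA>) \<mu>"
    and "continuous_on (UNIV \<times> \<AA>) \<sigma>"
    and "K > 0"
    and "\<And>x x' a. a \<in> \<AA> \<Longrightarrow>
           norm (\<mu> (x, a) - \<mu> (x', a)) + norm (\<sigma> (x, a) - \<sigma> (x', a)) \<le> K * norm (x - x')"
    and "\<And>x a. a \<in> \<AA> \<Longrightarrow>
           norm (\<mu> (x, a)) + norm (\<sigma> (x, a)) \<le> K * (1 + norm x + norm a)"
    and "\<And>A. A \<in> admissible_controls M T F \<AA> \<Longrightarrow>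
           strong_solution M T F W \<mu> \<sigma> x0 A (X A)"
    and "convex_on UNIV f"
    and "\<exists>C. \<forall>z y. \<bar>f (z, y)\<bar> \<le> C * (1 + \<bar>z\<bar>\<^sup>2 + (norm y)\<^sup>2)"
    and "convex_on UNIV g"
    and "\<exists>L. L-lipschitz_on UNIV g"
    and "convex \<AA>"
    and "\<And>A A' y y' \<theta>. A \<in> admissible_controls M T F \<AA> \<Longrightarrow> A' \<in> admissible_controls M T F \<AA> \<Longrightarrow>
           \<theta> \<in> {0..1} \<Longrightarrow>
           (AE \<omega> in M.
              f (g (X (\<lambda>t \<omega>'. \<theta> *\<^sub>R A t \<omega>' + (1 - \<theta>) *\<^sub>R A' t \<omega>') T \<omega>), \<theta> *\<^sub>R y + (1 - \<theta>) *\<^sub>R y')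
                \<le> \<theta> * f (g (X A T \<omega>), y) + (1 - \<theta>) * f (g (X A' T \<omega>), y'))"
  shows "(\<forall>y. \<forall>A\<in>admissible_controls M T F \<AA>. integrable M (\<lambda>\<omega>. f (g (X A T \<omega>), y))) \<and>
    (\<forall>y. bdd_below ((\<lambda>A. LINT \<omega>|M. f (g (X A T \<omega>), y)) ` admissible_controls M T F \<AA>)) \<and>
    convex_on UNIV (value_function M T (admissible_controls M T F \<AA>) X f g)"
proof -
  let ?C = "admissible_controls M T F \<AA>"
  interpret prob_space M by fact
  interpret brownian_filtration M T F W by unfold_locales fact+
  obtain C where C: "0 \<le> C" "\<And>A. A \<in> ?C \<Longrightarrow> (\<integral>\<^sup>+\<omega>. ennreal ((norm (X A T \<omega>))\<^sup>2) \<partial>M) \<le> ennreal C"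
    using controlled_diffusion_second_moment[OF assms(1) assms(8) compact_imp_bounded[OF assms(5)] assms(10)] assms(11)
    by metis
  obtain Cf L where Cf: "\<And>z y. \<bar>f (z, y)\<bar> \<le> Cf * (1 + \<bar>z\<bar>\<^sup>2 + (norm y)\<^sup>2)" and L: "L-lipschitz_on UNIV g"
    using assms(13,15) by blast
  define B where "B y = Cf * (1 + 2 * (g 0)\<^sup>2 + 2 * L\<^sup>2 + (norm y)\<^sup>2)" for y :: "real ^ 'm"
  \<comment> \<open>A real-valued convex function on a finite-dimensional space is continuous; this
    supplies measurability of the cost.\<close>
  have f_cont: "continuous_on UNIV f"
    using assms(12) by (intro convex_on_continuous) auto
  have "continuous_on UNIV (\<lambda>x. f (g x, y))" for y
    by (intro continuous_on_compose2[OF f_cont] continuous_intros lipschitz_on_continuous_on[OF L]) auto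
  then have fg_meas: "(\<lambda>x. f (g x, y)) \<in> borel_measurable borel" for y
    by (rule borel_measurable_continuous_onI)
  have X_meas: "X A T \<in> borel_measurable M" if "A \<in> ?C" for A
    using assms(1) assms(11)[OF that] by (intro measurable_F_M[of _ T]) (auto simp: strong_solution_def adapted_def)
  have growth: "\<bar>f (g x, y)\<bar> \<le> B y * (1 + (norm x)\<^sup>2)" for x y
    unfolding B_def by (rule lipschitz_quadratic_growth[OF Cf L])
  have int: "integrable M (\<lambda>\<omega>. f (g (X A T \<omega>), y))"
    and lower: "- (B y * (1 + C)) \<le> (LINT \<omega>|M. f (g (X A T \<omega>), y))" if "A \<in> ?C" for A y
    using quadratic_growth_expectation[OF X_meas[OF that] fg_meas growth C(1) C(2)[OF that]] by auto
  have bdd: "bdd_below ((\<lambda>A. LINT \<omega>|M. f (g (X A T \<omega>), y)) ` ?C)" for y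
    using lower by (intro bdd_belowI2)
  have "convex_on UNIV (\<lambda>y. INF A\<in>?C. (LINT \<omega>|M. f (g (X A T \<omega>), y)))"
  proof (rule convex_on_INF[OF bdd])
    fix A A' \<theta> and y y' :: "real ^ 'm"
    assume A: "A \<in> ?C" "A' \<in> ?C" and \<theta>: "\<theta> \<in> {0..1::real}"
    let ?A = "\<lambda>t \<omega>'. \<theta> *\<^sub>R A t \<omega>' + (1 - \<theta>) *\<^sub>R A' t \<omega>'"
    have mixed: "?A \<in> ?C"
      using assms(16) A \<theta> by (rule admissible_controls_convex_combination)
    \<comment> \<open>The almost sure inequality survives expectation because all three costs are
      integrable, the mixed one by admissibility of \<open>?A\<close>.\<close>
    have "(LINT \<omega>|M. f (g (X ?A T \<omega>), \<theta> *\<^sub>R y + (1 - \<theta>) *\<^sub>R y'))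
        \<le> (LINT \<omega>|M. \<theta> * f (g (X A T \<omega>), y) + (1 - \<theta>) * f (g (X A' T \<omega>), y'))"
      using assms(17)[OF A \<theta>] int A mixed by (intro integral_mono_AE) auto
    also have "\<dots> = \<theta> * (LINT \<omega>|M. f (g (X A T \<omega>), y)) + (1 - \<theta>) * (LINT \<omega>|M. f (g (X A' T \<omega>), y'))"
      using int A by simp
    finally show "\<exists>A''\<in>?C. (LINT \<omega>|M. f (g (X A'' T \<omega>), \<theta> *\<^sub>R y + (1 - \<theta>) *\<^sub>R y'))
        \<le> \<theta> * (LINT \<omega>|M. f (g (X A T \<omega>), y)) + (1 - \<theta>) * (LINT \<omega>|M. f (g (X A' T \<omega>), y'))"
      using mixed by blast
  qed
  then show ?thesis
    using int bdd by (simp add: value_function_def[abs_def])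
qed

end
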